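(* Let $X_1,\ldots,X_l$ be independent random variables and let $E_1,\ldots,E_m$ be events, each $E_j$ depending only on the variables in its scope $\mathrm{sc}(E_j)$, with $\Pr[E_j]=p_j\in(0,1)$ for $j=1,\ldots,m$ and $\bar p=(p_1,\ldots,p_m)$. Let $G$ be the undirected graph on $\{1,\ldots,m\}$ in which $\{i,j\}$, $i\neq j$, is an edge if and only if $E_j$ is $d$-dependent on $E_i$ or $E_i$ is $d$-dependent on $E_j$, and let $I(G)$ be the set of independent sets of $G$. If for all $I\in I(G)$ $$q_I(G,\bar{p}):=\sum_{J\in I(G):\ I\subseteq J} (-1)^{|J\setminus I|}\prod_{j\in J} p_j> 0,$$ then the probability $P_n$ that the algorithm MaxSetRes lasts for at least $n$ phases is exponentially small: there is a constant $c<1$ such that $P_n$ is at most $c^n$, ignoring polynomial factors (i.e. there are $c\in(0,1)$ and a polynomial $r$, not depending on $n$, with $P_n\le r(n)\,c^n$ for all $n\geq 1$).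
   Context: Variable framework: the probability space is the product space of independent random variables $X_1,\ldots,X_l$; each event $E_j$ is determined by the values of a subset $\mathrm{sc}(E_j)$ of these variables, called its scope. The numbers $l$ and $m$ are constants. $d$-dependency: $E_i$ is $d$-dependent on $E_j$ if there exists an assignment $\alpha$ of values to $X_1,\ldots,X_l$ under which $E_j$ occurs and $E_i$ does not, and such that the values of the variables in $\mathrm{sc}(E_j)$ can be changed (all other values of $\alpha$ being kept) so that $E_i$ occurs and $E_j$ ceases occurring. An independent set of $G$ is a set of vertices with no edges between them (the empty set included). $\Gamma_j$ denotes the set of neighbors of $j$ in $G$, and $\Gamma(I)=\bigcup_{j\in I}\Gamma_j$. Algorithm MaxSetRes. Sample (independently, from their distributions) $X_1,\ldots,X_l$. Set $t:=1$, $I_t:=\emptyset$. While there exists an event $E_j$ with $j\notin I_t\cup\Gamma(I_t)$ that occurs under the current assignment, let $E_j$ be the least indexed such event and do the following: (1) set $I_t:=I_t\cup\{j\}$ and $c:=0$; while $E_j$ occurs, resample independently the variables in $\mathrm{sc}(E_j)$ and set $c:=c+1$; (2) then, (a) if there is an occurring event with index not in $I_t\cup\Gamma(I_t)$, leave $t$ and $I_t$ unchanged; (b) else, if there is an occurring event with index not in $\Gamma_j$, set $t:=t+1$ and, for this new value of $t$, $I_t:=\{j\}$; (c) else, set $I_{t+s}:=\{j\}$ for $s=1,\ldots,c$, then $t:=t+c+1$ and, for this new $t$, $I_t:=\emptyset$. When no such event exists, output the current assignment and stop. The phases of an execution are indexed by the values of $t$: phase $t$ is the one during which the non-empty independent set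 $I_t$ is created (in case (c), $c$ phases are completed at once). The execution lasts for at least $n$ phases if it creates non-empty sets $I_1,\ldots,I_n$. *)

theory Defs
  imports "HOL-Probability.Probability"
begin

section \<open>Variable framework\<close>

text \<open>
  The variable \<open>X\<^sub>i\<close> (\<open>1 \<le> i \<le> l\<close>) has distribution \<open>M i\<close> and is the \<open>i\<close>-th coordinate on the
  product space; an assignment is a point of that space, and \<open>E j\<close> is a measurable set of
  assignments.
\<close>

definition var_space :: "nat \<Rightarrow> (nat \<Rightarrow> 'a measure) \<Rightarrow> (nat \<Rightarrow> 'a) measure" where
  "var_space l M = (\<Pi>\<^sub>M i\<in>{1..l}. M i)"

definition determined_by :: "(nat \<Rightarrow> 'a) measure \<Rightarrow> (nat \<Rightarrow> 'a) set \<Rightarrow> nat set \<Rightarrow> bool" where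
  "determined_by S A C \<longleftrightarrow>
     (\<forall>\<alpha>\<in>space S. \<forall>\<beta>\<in>space S. (\<forall>i\<in>C. \<alpha> i = \<beta> i) \<longrightarrow> (\<alpha> \<in> A \<longleftrightarrow> \<beta> \<in> A))"

text \<open>\<open>d_dependent S A B C\<close>: the event \<open>A\<close> is d-dependent on the event \<open>B\<close>, whose scope is \<open>C\<close>.\<close>

definition d_dependent ::
  "(nat \<Rightarrow> 'a) measure \<Rightarrow> (nat \<Rightarrow> 'a) set \<Rightarrow> (nat \<Rightarrow> 'a) set \<Rightarrow> nat set \<Rightarrow> bool" where
  "d_dependent S A B C \<longleftrightarrow>
     (\<exists>\<alpha>\<in>space S. \<alpha> \<in> B \<and> \<alpha> \<notin> A \<and>
        (\<exists>\<beta>\<in>space S. (\<forall>i. i \<notin> C \<longrightarrow> \<beta> i = \<alpha> i) \<and> \<beta> \<in> A \<and> \<beta> \<notin> B))"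


section \<open>The dependency graph and Shearer's polynomials\<close>

text \<open>A graph on \<open>{1..m}\<close> is given by its set of edges, each edge being a two-element set.\<close>

definition d_dep_graph ::
  "(nat \<Rightarrow> 'a) measure \<Rightarrow> nat \<Rightarrow> (nat \<Rightarrow> (nat \<Rightarrow> 'a) set) \<Rightarrow> (nat \<Rightarrow> nat set) \<Rightarrow> nat set set" where
  "d_dep_graph S m E sc =
     {{i, j} | i j. i \<in> {1..m} \<and> j \<in> {1..m} \<and> i \<noteq> j \<and>
        (d_dependent S (E j) (E i) (sc i) \<or> d_dependent S (E i) (E j) (sc j))}"

definition nbrs :: "nat set set \<Rightarrow> nat \<Rightarrow> nat set" where
  "nbrs G j = {i. {i, j} \<in> G}"

definition nbrs_set :: "nat set set \<Rightarrow> nat set \<Rightarrow> nat set" where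
  "nbrs_set G I = (\<Union>j\<in>I. nbrs G j)"

definition independent_sets :: "nat \<Rightarrow> nat set set \<Rightarrow> nat set set" where
  "independent_sets m G = {I. I \<subseteq> {1..m} \<and> (\<forall>i\<in>I. \<forall>j\<in>I. {i, j} \<notin> G)}"

definition shearer_q :: "nat \<Rightarrow> nat set set \<Rightarrow> (nat \<Rightarrow> real) \<Rightarrow> nat set \<Rightarrow> real" where
  "shearer_q m G p I =
     (\<Sum>J\<in>{J \<in> independent_sets m G. I \<subseteq> J}. (- 1) ^ card (J - I) * (\<Prod>j\<in>J. p j))"


section \<open>The algorithm MaxSetRes\<close>

text \<open>
  The algorithm is a small-step transition system driven by an infinite sequence \<open>\<omega>\<close> of mutually
  independent samples of all variables: \<open>\<omega> 0\<close> is the initial assignment, and the \<open>k\<close>-th execution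
  of the resampling instruction overwrites the variables of the scope in question by their values
  in \<open>\<omega> k\<close>. In \<open>Inner j c\<close> control is at the head of the inner loop for \<open>E j\<close> with counter \<open>c\<close>.
  The sets \<open>I\<^sub>s\<close> that have not been assigned yet are represented by the empty set.
\<close>

datatype control = Outer | Inner nat nat | Stopped

record 'a msr_state =
  asg :: "nat \<Rightarrow> 'a"
  drawn :: nat
  phase :: nat
  isets :: "nat \<Rightarrow> nat set"
  ctrl :: control

definition occurring :: "nat \<Rightarrow> (nat \<Rightarrow> (nat \<Rightarrow> 'a) set) \<Rightarrow> (nat \<Rightarrow> 'a) \<Rightarrow> nat set" where
  "occurring m E \<alpha> = {i \<in> {1..m}. \<alpha> \<in> E i}"

definition candidates ::
  "nat \<Rightarrow> (nat \<Rightarrow> (nat \<Rightarrow> 'a) set) \<Rightarrow> nat set set \<Rightarrow> 'a msr_state \<Rightarrow> nat set" where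
  "candidates m E G s =
     (let I = isets s (phase s) in occurring m E (asg s) - (I \<union> nbrs_set G I))"

definition msr_init :: "(nat \<Rightarrow> nat \<Rightarrow> 'a) \<Rightarrow> 'a msr_state" where
  "msr_init \<omega> = \<lparr>asg = \<omega> 0, drawn = 1, phase = 1, isets = (\<lambda>_. {}), ctrl = Outer\<rparr>"

definition msr_step ::
  "nat \<Rightarrow> (nat \<Rightarrow> (nat \<Rightarrow> 'a) set) \<Rightarrow> (nat \<Rightarrow> nat set) \<Rightarrow> nat set set \<Rightarrow>
   (nat \<Rightarrow> nat \<Rightarrow> 'a) \<Rightarrow> 'a msr_state \<Rightarrow> 'a msr_state" where
  "msr_step m E sc G \<omega> s =
     (let t = phase s; I = isets s in
      case ctrl s of
        Stopped \<Rightarrow> s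
      | Outer \<Rightarrow>
          if candidates m E G s = {} then s\<lparr>ctrl := Stopped\<rparr>
          else let j = Min (candidates m E G s) in
               s\<lparr>isets := I(t := I t \<union> {j}), ctrl := Inner j 0\<rparr>
      | Inner j c \<Rightarrow>
          if asg s \<in> E j then
            s\<lparr>asg := override_on (asg s) (\<omega> (drawn s)) (sc j), drawn := drawn s + 1,
              ctrl := Inner j (c + 1)\<rparr>
          else if candidates m E G s \<noteq> {} then s\<lparr>ctrl := Outer\<rparr>
          else if \<not> occurring m E (asg s) \<subseteq> nbrs G j then
            s\<lparr>phase := t + 1, isets := I(t + 1 := {j}), ctrl := Outer\<rparr>
          else
            s\<lparr>phase := t + c + 1,
              isets := (\<lambda>u. if u \<in> {t + 1..t + c} then {j} else if u = t + c + 1 then {} else I u),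
              ctrl := Outer\<rparr>)"

definition msr_run ::
  "nat \<Rightarrow> (nat \<Rightarrow> (nat \<Rightarrow> 'a) set) \<Rightarrow> (nat \<Rightarrow> nat set) \<Rightarrow> nat set set \<Rightarrow>
   (nat \<Rightarrow> nat \<Rightarrow> 'a) \<Rightarrow> nat \<Rightarrow> 'a msr_state" where
  "msr_run m E sc G \<omega> k = (msr_step m E sc G \<omega> ^^ k) (msr_init \<omega>)"

definition lasts_phases ::
  "nat \<Rightarrow> (nat \<Rightarrow> (nat \<Rightarrow> 'a) set) \<Rightarrow> (nat \<Rightarrow> nat set) \<Rightarrow> nat set set \<Rightarrow>
   nat \<Rightarrow> (nat \<Rightarrow> nat \<Rightarrow> 'a) \<Rightarrow> bool" where
  "lasts_phases m E sc G n \<omega> \<longleftrightarrow> (\<exists>k. \<forall>s\<in>{1..n}. isets (msr_run m E sc G \<omega> k) s \<noteq> {})"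

definition sample_space :: "nat \<Rightarrow> (nat \<Rightarrow> 'a measure) \<Rightarrow> (nat \<Rightarrow> nat \<Rightarrow> 'a) measure" where
  "sample_space l M = (\<Pi>\<^sub>M k\<in>(UNIV::nat set). var_space l M)"

definition msr_prob ::
  "nat \<Rightarrow> (nat \<Rightarrow> 'a measure) \<Rightarrow> nat \<Rightarrow> (nat \<Rightarrow> (nat \<Rightarrow> 'a) set) \<Rightarrow> (nat \<Rightarrow> nat set) \<Rightarrow>
   nat set set \<Rightarrow> nat \<Rightarrow> real" where
  "msr_prob l M m E sc G n =
     measure (sample_space l M)
       {\<omega> \<in> space (sample_space l M). lasts_phases m E sc G n \<omega>}"


text \<open>
  The set measured in \<open>msr_prob\<close> is an event of the sample space (\<open>lasts_phases_sets\<close> below), so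
  that \<open>measure\<close> does not return its default value \<open>0\<close> there.
\<close>

definition msr_disc :: "'a msr_state \<Rightarrow> nat \<times> nat \<times> (nat \<Rightarrow> nat set) \<times> control" where
  "msr_disc s = (drawn s, phase s, isets s, ctrl s)"

fun disc_step ::
  "nat set set \<Rightarrow> nat \<times> nat \<times> (nat \<Rightarrow> nat set) \<times> control \<Rightarrow> nat set \<Rightarrow>
   nat \<times> nat \<times> (nat \<Rightarrow> nat set) \<times> control" where
  "disc_step G (r, t, I, q) Q =
    (let K = Q - (I t \<union> nbrs_set G (I t)) in
     case q of
       Stopped \<Rightarrow> (r, t, I, q)
     | Outer \<Rightarrow> if K = {} then (r, t, I, Stopped)
          else (r, t, I(t := I t \<union> {Min K}), Inner (Min K) 0)
     | Inner j c \<Rightarrow>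
          if j \<in> Q then (r + 1, t, I, Inner j (c + 1))
          else if K \<noteq> {} then (r, t, I, Outer)
          else if \<not> Q \<subseteq> nbrs G j then (r, t + 1, I(t + 1 := {j}), Outer)
          else (r, t + c + 1,
            (\<lambda>u. if u \<in> {t + 1..t + c} then {j} else if u = t + c + 1 then {} else I u), Outer))"

lemma msr_disc_step:
  assumes j: "\<And>j c. ctrl s = Inner j c \<Longrightarrow> j \<in> {1..m}"
  shows "msr_disc (msr_step m E sc G \<omega> s) = disc_step G (msr_disc s) (occurring m E (asg s))"
proof (cases "ctrl s")
  case (Inner j c)
  then have "asg s \<in> E j \<longleftrightarrow> j \<in> occurring m E (asg s)"
    using j by (auto simp: occurring_def)
  with Inner show ?thesis
    by (simp add: msr_disc_def msr_step_def Let_def candidates_def)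
qed (auto simp: msr_disc_def msr_step_def Let_def candidates_def)

lemma asg_msr_step:
  assumes j: "\<And>j c. ctrl s = Inner j c \<Longrightarrow> j \<in> {1..m}"
  shows "asg (msr_step m E sc G \<omega> s) =
    (case msr_disc s of (r, t, I, q) \<Rightarrow>
      (case q of Inner j c \<Rightarrow>
         if j \<in> occurring m E (asg s) then override_on (asg s) (\<omega> r) (sc j) else asg s
       | _ \<Rightarrow> asg s))"
proof (cases "ctrl s")
  case (Inner j c)
  then have "asg s \<in> E j \<longleftrightarrow> j \<in> occurring m E (asg s)"
    using j by (auto simp: occurring_def)
  with Inner show ?thesis
    by (simp add: msr_disc_def msr_step_def Let_def)
qed (auto simp: msr_disc_def msr_step_def Let_def)

lemma msr_run_Suc: "msr_run m E sc G \<omega> (Suc k) = msr_step m E sc G \<omega> (msr_run m E sc G \<omega> k)"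
  by (simp add: msr_run_def)

lemma msr_run_Inner:
  "ctrl (msr_run m E sc G \<omega> k) = Inner j c \<Longrightarrow> j \<in> {1..m}"
proof (induction k arbitrary: j c)
  case 0
  then show ?case by (simp add: msr_run_def msr_init_def)
next
  case (Suc k)
  let ?s = "msr_run m E sc G \<omega> k"
  have "candidates m E G ?s \<noteq> {} \<Longrightarrow> Min (candidates m E G ?s) \<in> {1..m}"
  proof -
    assume "candidates m E G ?s \<noteq> {}"
    moreover have sub: "candidates m E G ?s \<subseteq> {1..m}"
      by (auto simp: candidates_def occurring_def Let_def)
    moreover have "finite (candidates m E G ?s)"
      using sub by (rule finite_subset) simp
    ultimately show ?thesis
      using Min_in by blast
  qed
  with Suc show ?case
    by (cases "ctrl ?s") (auto simp: msr_run_Suc msr_step_def Let_def split: if_splits)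
qed

lemma simple_function_occurring:
  assumes a: "a \<in> measurable S V" and E: "\<And>j. j \<in> {1..m} \<Longrightarrow> E j \<in> sets V"
  shows "simple_function S (\<lambda>\<omega>. occurring m E (a \<omega>))"
  unfolding simple_function_def
proof (intro conjI ballI)
  show "finite ((\<lambda>\<omega>. occurring m E (a \<omega>)) ` space S)"
    by (rule finite_subset[of _ "Pow {1..m}"]) (auto simp: occurring_def)
  fix D assume "D \<in> (\<lambda>\<omega>. occurring m E (a \<omega>)) ` space S"
  then have D: "D \<subseteq> {1..m}"
    by (auto simp: occurring_def)
  have "(\<lambda>\<omega>. occurring m E (a \<omega>)) -` {D} \<inter> space S =
    {\<omega> \<in> space S. \<forall>i\<in>{1..m}. \<omega> \<in> (if i \<in> D then a -` E i \<inter> space S else space S - (a -` E i \<inter> space S))}"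
    (is "_ = ?R")
  proof (intro set_eqI)
    fix \<omega>
    have "occurring m E (a \<omega>) = D \<longleftrightarrow> (\<forall>i\<in>{1..m}. a \<omega> \<in> E i \<longleftrightarrow> i \<in> D)"
      unfolding occurring_def using D by fast
    then show "\<omega> \<in> (\<lambda>\<omega>. occurring m E (a \<omega>)) -` {D} \<inter> space S \<longleftrightarrow> \<omega> \<in> ?R"
      by auto
  qed
  also have "\<dots> \<in> sets S"
  proof (rule sets.sets_Collect_finite_All)
    show "{\<omega> \<in> space S. \<omega> \<in> (if i \<in> D then a -` E i \<inter> space S else space S - (a -` E i \<inter> space S))} \<in> sets S"
      if "i \<in> {1..m}" for i
    proof -
      have "a -` E i \<inter> space S \<in> sets S"
        using a E[OF that] by (rule measurable_sets)
      moreover have "{\<omega> \<in> space S. \<omega> \<in> a -` E i \<inter> space S} = a -` E i \<inter> space S"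
        "{\<omega> \<in> space S. \<omega> \<in> space S - (a -` E i \<inter> space S)} = space S - (a -` E i \<inter> space S)"
        by auto
      ultimately show ?thesis
        by (cases "i \<in> D") simp_all
    qed
  qed simp_all
  finally show "(\<lambda>\<omega>. occurring m E (a \<omega>)) -` {D} \<inter> space S \<in> sets S" .
qed

lemma msr_run_measurable:
  fixes M :: "nat \<Rightarrow> 'a measure"
  assumes sc: "\<And>j. j \<in> {1..m} \<Longrightarrow> sc j \<subseteq> {1..l}"
    and E: "\<And>j. j \<in> {1..m} \<Longrightarrow> E j \<in> sets (var_space l M)"
  shows "(\<lambda>\<omega>. asg (msr_run m E sc G \<omega> k)) \<in> measurable (sample_space l M) (var_space l M)"
    and "simple_function (sample_space l M) (\<lambda>\<omega>. msr_disc (msr_run m E sc G \<omega> k))"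
proof (induction k)
  case 0
  { case 1
    show ?case
      by (simp add: msr_run_def msr_init_def sample_space_def)
  next
    case 2
    show ?case
      by (simp add: msr_run_def msr_init_def msr_disc_def)
  }
next
  case (Suc k)
  let ?a = "\<lambda>\<omega>. asg (msr_run m E sc G \<omega> k)"
  let ?d = "\<lambda>\<omega>. msr_disc (msr_run m E sc G \<omega> k)"
  let ?o = "\<lambda>\<omega>. occurring m E (?a \<omega>)"
  let ?S = "sample_space l M"
  have am: "?a \<in> measurable ?S (var_space l M)" and ds: "simple_function ?S ?d"
    using Suc.IH by auto
  have os: "simple_function ?S ?o"
    using am E by (rule simple_function_occurring)
  have ps: "simple_function ?S (\<lambda>\<omega>. (?d \<omega>, ?o \<omega>))"
    by (rule simple_function_compose2[OF ds os])
  { case 2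
    have "msr_disc (msr_run m E sc G \<omega> (Suc k)) = disc_step G (?d \<omega>) (?o \<omega>)" for \<omega>
      unfolding msr_run_Suc by (rule msr_disc_step) (rule msr_run_Inner)
    then show ?case
      using simple_function_compose2[OF ds os, of "disc_step G"] by simp
  next
    case 1
    define f where "f = (\<lambda>(d :: nat \<times> nat \<times> (nat \<Rightarrow> nat set) \<times> control, Q) \<omega>.
      case d of (r, t, I, q) \<Rightarrow>
        (case q of Inner j c \<Rightarrow>
           if j \<in> Q then override_on (?a \<omega>) (\<omega> r) (sc j) else ?a \<omega>
         | _ \<Rightarrow> ?a \<omega>))"
    have eq: "asg (msr_run m E sc G \<omega> (Suc k)) = f (?d \<omega>, ?o \<omega>) \<omega>" for \<omega>
      unfolding msr_run_Suc f_def prod.case by (rule asg_msr_step) (rule msr_run_Inner)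
    let ?D = "(\<lambda>\<omega>. (?d \<omega>, ?o \<omega>)) ` space ?S"
    have ov: "(\<lambda>\<omega>. override_on (?a \<omega>) (\<omega> r) (sc j)) \<in> measurable ?S (var_space l M)"
      if "j \<in> {1..m}" for r j
    proof -
      have sj: "sc j \<subseteq> {1..l}" using that by (rule sc)
      have wm: "(\<lambda>\<omega>. \<omega> r) \<in> measurable ?S (var_space l M)"
        by (simp add: sample_space_def)
      show ?thesis
        unfolding var_space_def
      proof (rule measurable_PiM_single')
        show "(\<lambda>\<omega>. override_on (?a \<omega>) (\<omega> r) (sc j) i) \<in> measurable ?S (M i)"
          if "i \<in> {1..l}" for i
          using measurable_compose[OF am[unfolded var_space_def] measurable_component_singleton[OF that]]
            measurable_compose[OF wm[unfolded var_space_def] measurable_component_singleton[OF that]]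
          by (cases "i \<in> sc j") simp_all
        show "(\<lambda>\<omega>. override_on (?a \<omega>) (\<omega> r) (sc j)) \<in> space ?S \<rightarrow> (\<Pi>\<^sub>E i\<in>{1..l}. space (M i))"
        proof
          fix \<omega> assume w: "\<omega> \<in> space ?S"
          have "?a \<omega> \<in> (\<Pi>\<^sub>E i\<in>{1..l}. space (M i))" "\<omega> r \<in> (\<Pi>\<^sub>E i\<in>{1..l}. space (M i))"
            using measurable_space[OF am w] measurable_space[OF wm w]
            by (simp_all add: var_space_def space_PiM)
          with sj show "override_on (?a \<omega>) (\<omega> r) (sc j) \<in> (\<Pi>\<^sub>E i\<in>{1..l}. space (M i))"
            by (auto simp: override_on_def PiE_iff extensional_def)
        qed
      qed
    qed
    have "f x \<in> measurable ?S (var_space l M)" if x: "x \<in> ?D" for x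
    proof -
      obtain r t I q Q where [simp]: "x = ((r, t, I, q), Q)"
        by (metis prod.exhaust)
      have "j \<in> {1..m}" if "q = Inner j c" for j c
        using x that by (auto simp: msr_disc_def dest!: sym[of "Inner _ _"] msr_run_Inner)
      then show ?thesis
        using am ov by (cases q) (auto simp: f_def)
    qed
    moreover have "(\<lambda>\<omega>. (?d \<omega>, ?o \<omega>)) \<in> measurable ?S (count_space ?D)"
      using ps by (auto simp: simple_function_def measurable_count_space_eq2)
    moreover have "countable ?D"
      using ps by (auto simp: simple_function_def intro: countable_finite)
    ultimately have "(\<lambda>\<omega>. f (?d \<omega>, ?o \<omega>) \<omega>) \<in> measurable ?S (var_space l M)"
      by (rule measurable_compose_countable'[where g = "\<lambda>\<omega>. (?d \<omega>, ?o \<omega>)"])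
    then show ?case
      unfolding eq .
  }
qed

lemma lasts_phases_sets:
  fixes M :: "nat \<Rightarrow> 'a measure"
  assumes "\<And>j. j \<in> {1..m} \<Longrightarrow> sc j \<subseteq> {1..l}"
    and "\<And>j. j \<in> {1..m} \<Longrightarrow> E j \<in> sets (var_space l M)"
  shows "{\<omega> \<in> space (sample_space l M). lasts_phases m E sc G n \<omega>} \<in> sets (sample_space l M)"
proof -
  let ?S = "sample_space l M"
  have "{\<omega> \<in> space ?S. \<forall>s\<in>{1..n}. isets (msr_run m E sc G \<omega> k) s \<noteq> {}} \<in> sets ?S" for k
  proof -
    have "simple_function ?S (\<lambda>\<omega>. msr_disc (msr_run m E sc G \<omega> k))"
      using assms by (rule msr_run_measurable(2))
    then have "simple_function ?S
        (\<lambda>\<omega>. (\<lambda>(r, t, I, q). \<forall>s\<in>{1..n}. I s \<noteq> {}) (msr_disc (msr_run m E sc G \<omega> k)))"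
      by (rule simple_function_compose1)
    then have "simple_function ?S (\<lambda>\<omega>. \<forall>s\<in>{1..n}. isets (msr_run m E sc G \<omega> k) s \<noteq> {})"
      by (simp add: msr_disc_def)
    from simple_functionD(2)[OF this, of "{True}"] show ?thesis
      by (simp add: vimage_def Int_def conj_commute)
  qed
  then have "(\<Union>k. {\<omega> \<in> space ?S. \<forall>s\<in>{1..n}. isets (msr_run m E sc G \<omega> k) s \<noteq> {}}) \<in> sets ?S"
    by blast
  also have "(\<Union>k. {\<omega> \<in> space ?S. \<forall>s\<in>{1..n}. isets (msr_run m E sc G \<omega> k) s \<noteq> {}}) =
      {\<omega> \<in> space ?S. lasts_phases m E sc G n \<omega>}"
    by (auto simp: lasts_phases_def)
  finally show ?thesis .
qed

end

theory Submission
  imports Defs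
begin

text \<open>
  Record the word of successive resamplings. For a fixed word, the probability that all its letters
  occur when they are resampled is the product of their probabilities, because resampling the scope
  of an occurring event restores the product distribution. Executed words are determined step by
  step by the letters of the remaining word that could be commuted to its front: such letters occur
  already, by d-dependency, and the algorithm chooses among the occurring events by a priority that
  depends on the past only. The identity \<open>q\<^sub>A = p\<^sub>a \<Sum>\<^sub>B q\<^sub>B\<close> (for \<open>a \<in> A\<close>, over the independent \<open>B\<close>
  that agree with \<open>A - {a}\<close> outside \<open>\<Gamma>\<^sub>a \<union> {a}\<close>) then bounds the total weight of the words of a given
  length whose set of such letters is \<open>A\<close> by \<open>q\<^sub>A / q\<^sub>\<emptyset>\<close>. All \<open>q\<^sub>I\<close> remain positive when the
  probabilities are multiplied by some \<open>\<rho> > 1\<close>, so words of length \<open>N\<close> have total weight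
  \<open>O(\<rho>\<^sup>-\<^sup>N)\<close>. An inner loop with \<open>c \<ge> 1\<close> resamplings advances the phase by at most
  \<open>c + 1 \<le> 2 c\<close>, so \<open>n\<close> phases require at least \<open>\<lfloor>n/2\<rfloor>\<close> resamplings.
\<close>

section \<open>Shearer's polynomials\<close>

lemma independent_sets_mono:
  assumes "J \<in> independent_sets m G" "I \<subseteq> J"
  shows "I \<in> independent_sets m G"
  using assms by (auto simp: independent_sets_def)

lemma independent_sets_insert:
  assumes J: "J \<in> independent_sets m G" and a: "a \<in> {1..m}" "{a} \<notin> G" "J \<inter> nbrs G a = {}"
  shows "insert a J \<in> independent_sets m G"
proof -
  have JG: "{i, j} \<notin> G" if "i \<in> J" "j \<in> J" for i j
    using J that unfolding independent_sets_def by blast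
  have ia: "{i, a} \<notin> G" if "i \<in> J" for i
    using a(3) that unfolding nbrs_def by blast
  have ai: "{a, i} \<notin> G" if "i \<in> J" for i
    using ia[OF that] by (simp add: insert_commute)
  have "{i, j} \<notin> G" if "i \<in> insert a J" "j \<in> insert a J" for i j
    using that a(2) by (elim insertE) (simp_all add: JG ia ai)
  moreover have "insert a J \<subseteq> {1..m}"
    using J a(1) unfolding independent_sets_def by blast
  ultimately show ?thesis
    unfolding independent_sets_def by blast
qed

lemma finite_independent_sets: "finite (independent_sets m G)"
  by (rule finite_subset[of _ "Pow {1..m}"]) (auto simp: independent_sets_def)

lemma finite_mem_independent_sets: "I \<in> independent_sets m G \<Longrightarrow> finite I"
  by (auto simp: independent_sets_def intro: finite_subset)

section \<open>Alternating sums over set intervals and the recursion for q\<close>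

text \<open>Toggling a fixed element of \<open>X - U\<close> pairs the even with the odd sets of the
  interval. This cancellation drives the recursion for q.\<close>

lemma sum_interval_alternating:
  assumes "finite X" "U \<subset> X"
  shows "(\<Sum>B | B \<subseteq> X \<and> U \<subseteq> B. (- 1) ^ card B) = (0::'a::ring_1)"
proof (rule sum_alternating_cancels)
  show "finite {B. B \<subseteq> X \<and> U \<subseteq> B}"
    using assms(1) by simp
  show "card {B \<in> {B. B \<subseteq> X \<and> U \<subseteq> B}. even (card B)} = card {B \<in> {B. B \<subseteq> X \<and> U \<subseteq> B}. odd (card B)}"
    using card_subsupersets_even_odd[OF assms] by (simp add: conj_assoc)
qed

lemma neg_one_power_card_diff:
  assumes "finite J" "B \<subseteq> J"
  shows "(- 1) ^ card (J - B) = (- 1) ^ card J * ((- 1) ^ card B :: 'a::ring_1)"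
proof -
  have "card J = card (J - B) + card B"
    using card_Diff_subset[OF finite_subset[OF assms(2,1)] assms(2)] card_mono[OF assms] by simp
  moreover have "(- 1) ^ card B * (- 1) ^ card B = (1::'a)"
    by (simp flip: power_add)
  ultimately show ?thesis
    by (simp add: power_add mult.assoc)
qed

text \<open>Expand every q on the right and exchange the sums. For a fixed \<open>J\<close> the sets
  \<open>B\<close> form an interval, so their signs cancel unless \<open>J\<close> avoids
  \<open>a\<close> and its neighbours; adding \<open>a\<close> to the surviving \<open>J\<close>
  gives exactly the independent supersets of \<open>A\<close>.\<close>

lemma shearer_q_recursion:
  assumes A: "A \<in> independent_sets m G" and a: "a \<in> A"
  shows "shearer_q m G p A =
    p a * (\<Sum>B | B \<in> independent_sets m G \<and> B - insert a (nbrs G a) = A - {a}. shearer_q m G p B)"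
proof -
  let ?I = "independent_sets m G"
  define C where "C = insert a (nbrs G a)"
  define A' where "A' = A - {a}"
  define P where "P J = (\<Prod>j\<in>J. p j)" for J
  have AG: "{i, j} \<notin> G" if "i \<in> A" "j \<in> A" for i j
    using A that unfolding independent_sets_def by blast
  have A'C: "A' \<inter> C = {}"
    using AG[OF _ a] by (auto simp: A'_def C_def nbrs_def)
  have A': "A = insert a A'" "a \<notin> A'"
    using a by (auto simp: A'_def)
  have aa: "{a} \<notin> G" "a \<in> {1..m}"
    using AG[OF a a] A a unfolding independent_sets_def by auto
  let ?T = "\<lambda>B J. (- 1) ^ card (J - B) * P J"
  let ?S = "{B \<in> ?I. B - C = A'}"
  have inner: "(\<Sum>B\<in>{B \<in> ?S. B \<subseteq> J}. ?T B J) =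
      (if A' \<subseteq> J \<and> J \<inter> C = {} then (- 1) ^ card (J - A') * P J else 0)" if J: "J \<in> ?I" for J
  proof (cases "A' \<subseteq> J")
    case False
    then have "{B \<in> ?S. B \<subseteq> J} = {}" by auto
    with False show ?thesis by (simp only: sum.empty simp_thms if_False)
  next
    case True
    have fin: "finite J"
      using J by (rule finite_mem_independent_sets)
    \<comment> \<open>Independence of \<open>B\<close> is inherited from \<open>J\<close>, so the
      admissible \<open>B\<close> fill a whole interval above \<open>A'\<close>, which is a single
      point exactly when \<open>J\<close> is disjoint from \<open>C\<close>.\<close>
    have eq: "{B \<in> ?S. B \<subseteq> J} = {B. B \<subseteq> A' \<union> (J \<inter> C) \<and> A' \<subseteq> B}"
    proof -
      have "B \<in> ?I" if "B \<subseteq> A' \<union> (J \<inter> C)" for B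
        using that True by (intro independent_sets_mono[OF J]) blast
      with True A'C show ?thesis by auto
    qed
    have "(\<Sum>B\<in>{B \<in> ?S. B \<subseteq> J}. ?T B J) =
        (\<Sum>B | B \<subseteq> A' \<union> (J \<inter> C) \<and> A' \<subseteq> B. (- 1) ^ card J * P J * (- 1) ^ card B)"
      unfolding eq
    proof (rule sum.cong)
      fix B assume "B \<in> {B. B \<subseteq> A' \<union> (J \<inter> C) \<and> A' \<subseteq> B}"
      then have "B \<subseteq> J" using True by blast
      then show "?T B J = (- 1) ^ card J * P J * (- 1) ^ card B"
        by (simp add: neg_one_power_card_diff[OF fin])
    qed simp
    also have "\<dots> = (- 1) ^ card J * P J * (\<Sum>B | B \<subseteq> A' \<union> (J \<inter> C) \<and> A' \<subseteq> B. (- 1) ^ card B)"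
      by (simp add: sum_distrib_left)
    also have "\<dots> = (if J \<inter> C = {} then (- 1) ^ card (J - A') * P J else 0)"
    proof (cases "J \<inter> C = {}")
      case True
      then have "{B. B \<subseteq> A' \<union> (J \<inter> C) \<and> A' \<subseteq> B} = {A'}" by auto
      with True \<open>A' \<subseteq> J\<close> show ?thesis
        by (simp add: neg_one_power_card_diff[OF fin])
    next
      case False
      then have "A' \<subset> A' \<union> (J \<inter> C)" using A'C by auto
      moreover have "finite (A' \<union> (J \<inter> C))"
        using fin True by (auto intro: finite_subset)
      ultimately have "(\<Sum>B | B \<subseteq> A' \<union> (J \<inter> C) \<and> A' \<subseteq> B. (- 1) ^ card B) = (0::real)"
        by (intro sum_interval_alternating)
      with False show ?thesis by simp
    qed
    finally show ?thesis using True by simp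
  qed
  have "(\<Sum>B\<in>?S. shearer_q m G p B) = (\<Sum>B\<in>?S. \<Sum>J\<in>{J \<in> ?I. B \<subseteq> J}. ?T B J)"
    by (simp add: shearer_q_def P_def)
  also have "\<dots> = (\<Sum>J\<in>?I. \<Sum>B\<in>{B \<in> ?S. B \<subseteq> J}. ?T B J)"
    by (rule sum.swap_restrict) (auto simp: finite_independent_sets)
  also have "\<dots> = (\<Sum>J\<in>?I. if A' \<subseteq> J \<and> J \<inter> C = {} then (- 1) ^ card (J - A') * P J else 0)"
    by (intro sum.cong inner) auto
  also have "\<dots> = (\<Sum>J\<in>{J \<in> ?I. A' \<subseteq> J \<and> J \<inter> C = {}}. (- 1) ^ card (J - A') * P J)"
    by (rule sum.inter_filter[symmetric]) (rule finite_independent_sets)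
  finally have "p a * (\<Sum>B\<in>?S. shearer_q m G p B) =
      (\<Sum>J\<in>{J \<in> ?I. A' \<subseteq> J \<and> J \<inter> C = {}}. (- 1) ^ card (J - A') * (p a * P J))"
    by (simp add: sum_distrib_left mult.left_commute)
  also have "\<dots> = (\<Sum>J\<in>{J \<in> ?I. A \<subseteq> J}. (- 1) ^ card (J - A) * P J)"
  proof (rule sum.reindex_bij_witness[where i = "\<lambda>J. J - {a}" and j = "insert a"])
    fix J assume J: "J \<in> {J \<in> ?I. A' \<subseteq> J \<and> J \<inter> C = {}}"
    then have aJ: "a \<notin> J" "finite J" and JN: "J \<inter> nbrs G a = {}"
      by (auto simp: C_def finite_mem_independent_sets)
    show "insert a J - {a} = J" using aJ by simp
    show "insert a J \<in> {J \<in> ?I. A \<subseteq> J}"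
      using J A'(1) aa JN by (auto intro!: independent_sets_insert)
    have "insert a J - A = J - A'"
      using A' aJ by auto
    moreover have "P (insert a J) = p a * P J"
      unfolding P_def using aJ by simp
    ultimately show "(- 1) ^ card (insert a J - A) * P (insert a J) = (- 1) ^ card (J - A') * (p a * P J)"
      by simp
  next
    fix J assume J: "J \<in> {J \<in> ?I. A \<subseteq> J}"
    then show "insert a (J - {a}) = J" using a by auto
    have "{i, a} \<notin> G" if "i \<in> J" for i
      using J a that by (auto simp: independent_sets_def)
    then have "J \<inter> nbrs G a = {}"
      by (auto simp: nbrs_def)
    moreover have "J - {a} \<in> ?I"
      using J by (auto intro: independent_sets_mono[of J])
    ultimately show "J - {a} \<in> {J \<in> ?I. A' \<subseteq> J \<and> J \<inter> C = {}}"
      using J by (auto simp: A'_def C_def)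
  qed
  finally show ?thesis
    by (simp add: shearer_q_def P_def C_def A'_def)
qed

text \<open>There are finitely many independent sets and each q is continuous in the scaling factor,
  so positivity at 1 persists slightly to the right of 1. This slack provides the exponential
  rate.\<close>

lemma shearer_q_scale_pos:
  assumes "\<And>I. I \<in> independent_sets m G \<Longrightarrow> shearer_q m G p I > 0"
  obtains \<rho> where "\<rho> > 1" "\<And>I. I \<in> independent_sets m G \<Longrightarrow> shearer_q m G (\<lambda>j. \<rho> * p j) I > 0"
proof -
  have "eventually (\<lambda>\<rho>. shearer_q m G (\<lambda>j. \<rho> * p j) I > 0) (at_right (1::real))"
    if "I \<in> independent_sets m G" for I
  proof -
    have "((\<lambda>\<rho>. shearer_q m G (\<lambda>j. \<rho> * p j) I) \<longlongrightarrow> shearer_q m G (\<lambda>j. 1 * p j) I) (at_right 1)"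
      unfolding shearer_q_def by (intro tendsto_intros)
    then show ?thesis
      using assms[OF that] by (intro order_tendstoD(1)[where a = 0]) simp_all
  qed
  then have "eventually (\<lambda>\<rho>. \<forall>I\<in>independent_sets m G. shearer_q m G (\<lambda>j. \<rho> * p j) I > 0) (at_right (1::real))"
    by (intro eventually_ball_finite finite_independent_sets) auto
  then have "eventually (\<lambda>\<rho>. \<rho> > 1 \<and> (\<forall>I\<in>independent_sets m G. shearer_q m G (\<lambda>j. \<rho> * p j) I > 0))
      (at_right (1::real))"
    using eventually_at_right_less[of "1::real"] by eventually_elim auto
  from eventually_happens[OF this] show ?thesis
    using that by auto
qed


section \<open>Words produced by a priority rule\<close>

text \<open>
  \<open>mins G w\<close> consists of the letters of \<open>w\<close> that can be moved to the front by swapping adjacent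
  distinct letters that are not neighbours.
\<close>

fun mins :: "nat set set \<Rightarrow> nat list \<Rightarrow> nat set" where
  "mins G [] = {}"
| "mins G (a # w) = insert a (mins G w - nbrs G a)"

text \<open>The rule sees the letters already read only through the state, and the remaining word
  only through its possible first letters. At a given state that set alone therefore fixes the next
  letter.\<close>

fun obeys ::
  "nat set set \<Rightarrow> ('s \<Rightarrow> nat set \<Rightarrow> nat) \<Rightarrow> ('s \<Rightarrow> nat \<Rightarrow> 's) \<Rightarrow> 's \<Rightarrow> nat list \<Rightarrow> bool" where
  "obeys G pick upd s [] \<longleftrightarrow> True"
| "obeys G pick upd s (a # w) \<longleftrightarrow> a = pick s (mins G (a # w)) \<and> obeys G pick upd (upd s a) w"

definition obeying_words where
  "obeying_words m G pick upd s N = {w. set w \<subseteq> {1..m} \<and> length w = N \<and> obeys G pick upd s w}"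

lemma finite_obeying_words: "finite (obeying_words m G pick upd s N)"
  by (rule finite_subset[OF _ finite_lists_length_eq[of "{1..m}" N]]) (auto simp: obeying_words_def)

text \<open>Prefixing \<open>a\<close> removes the neighbours of \<open>a\<close> from the set, so
  no edge at \<open>a\<close> can arise. Irreflexivity enters because
  \<open>independent_sets\<close> also tests \<open>{i, i}\<close>.\<close>

lemma mins_independent:
  assumes "\<And>i. {i} \<notin> G" "set w \<subseteq> {1..m}"
  shows "mins G w \<in> independent_sets m G"
  using assms(2)
proof (induction w)
  case (Cons a w)
  then have "mins G w - nbrs G a \<in> independent_sets m G"
    by (auto intro: independent_sets_mono[of "mins G w"])
  with Cons.prems show ?case
    using assms(1) by (auto intro!: independent_sets_insert)
qed (simp add: independent_sets_def)

text \<open>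
  If the first letter \<open>a\<close> is determined by \<open>A = mins G (a # w)\<close>, the only choice left is \<open>mins G w\<close>,
  which ranges over the sets \<open>B\<close> of \<open>shearer_q_recursion\<close>.
\<close>

lemma obeying_words_mins_le:
  fixes p :: "nat \<Rightarrow> real"
  assumes irr: "\<And>i. {i} \<notin> G" and p: "\<And>j. j \<in> {1..m} \<Longrightarrow> p j \<ge> 0"
    and q: "\<And>I. I \<in> independent_sets m G \<Longrightarrow> shearer_q m G p I > 0"
    and A: "A \<in> independent_sets m G"
  shows "(\<Sum>w | w \<in> obeying_words m G pick upd s N \<and> mins G w = A. prod_list (map p w))
    \<le> shearer_q m G p A / shearer_q m G p {}"
  using A
proof (induction N arbitrary: s A)
  case 0
  have "shearer_q m G p {} > 0"
    by (rule q) (simp add: independent_sets_def)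
  moreover have "{w. w \<in> obeying_words m G pick upd s 0 \<and> mins G w = A} = (if A = {} then {[]} else {})"
    by (auto simp: obeying_words_def)
  ultimately show ?case
    using q[OF 0] by (auto simp: field_simps)
next
  case (Suc N)
  let ?W = "\<lambda>s N A. {w. w \<in> obeying_words m G pick upd s N \<and> mins G w = A}"
  let ?a = "pick s A"
  let ?I = "independent_sets m G"
  have q0: "shearer_q m G p {} > 0"
    by (rule q) (simp add: independent_sets_def)
  have hd: "a = ?a \<and> a \<in> A \<and> a \<in> {1..m}" if "a # w \<in> ?W s (Suc N) A" for a w
    using that by (auto simp: obeying_words_def)
  show ?case
  \<comment> \<open>Without such words the bound is mere positivity of q. Otherwise a word witnesses
    that the picked letter lies in \<open>A\<close>, which an arbitrary \<open>pick\<close> does not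
    guarantee.\<close>
  proof (cases "?W s (Suc N) A = {}")
    case True
    show ?thesis
      unfolding True using q[OF Suc.prems] q0 by (simp add: field_simps)
  next
    case False
    then obtain w where w: "w \<in> ?W s (Suc N) A" by blast
    then obtain b u where "w = b # u"
      by (cases w) (auto simp: obeying_words_def)
    then have a: "?a \<in> A" "?a \<in> {1..m}"
      using hd[of b u] w by auto
    let ?B = "{B \<in> ?I. B - insert ?a (nbrs G ?a) = A - {?a}}"
    let ?s = "upd s ?a"
    have finB: "finite ?B"
      using finite_independent_sets by simp
    have finW: "finite (?W s N A)" for s N A
      using finite_obeying_words[of m G pick upd s N] by simp
    have sub: "?W s (Suc N) A \<subseteq> (#) ?a ` (\<Union>B\<in>?B. ?W ?s N B)"
    proof
      fix v assume v: "v \<in> ?W s (Suc N) A"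
      then obtain b u where [simp]: "v = b # u"
        by (cases v) (auto simp: obeying_words_def)
      have b: "b = ?a" using hd v by simp
      have "mins G u \<in> ?I"
        using v by (intro mins_independent irr) (auto simp: obeying_words_def)
      moreover have "mins G u - insert ?a (nbrs G ?a) = A - {?a}"
        using v b irr[of ?a] by (auto simp: nbrs_def)
      ultimately show "v \<in> (#) ?a ` (\<Union>B\<in>?B. ?W ?s N B)"
        using v b by (auto simp: obeying_words_def)
    qed
    have pos: "prod_list (map p w) \<ge> 0" if "set w \<subseteq> {1..m}" for w
      using that p by (intro prod_list_nonneg) auto
    have "(\<Sum>w\<in>?W s (Suc N) A. prod_list (map p w))
        \<le> (\<Sum>w\<in>(#) ?a ` (\<Union>B\<in>?B. ?W ?s N B). prod_list (map p w))"
      using a finB finW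
      by (intro sum_mono2 sub) (auto simp: obeying_words_def intro!: pos p mult_nonneg_nonneg)
    also have "\<dots> = (\<Sum>w\<in>(\<Union>B\<in>?B. ?W ?s N B). p ?a * prod_list (map p w))"
      by (subst sum.reindex) auto
    also have "\<dots> = p ?a * (\<Sum>w\<in>(\<Union>B\<in>?B. ?W ?s N B). prod_list (map p w))"
      by (simp add: sum_distrib_left)
    also have "(\<Sum>w\<in>(\<Union>B\<in>?B. ?W ?s N B). prod_list (map p w)) =
        (\<Sum>B\<in>?B. \<Sum>w\<in>?W ?s N B. prod_list (map p w))"
      using finB finW by (intro sum.UNION_disjoint) auto
    also have "p ?a * \<dots> \<le> p ?a * (\<Sum>B\<in>?B. shearer_q m G p B / shearer_q m G p {})"
      using p[OF a(2)] by (intro mult_left_mono sum_mono Suc.IH) auto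
    also have "\<dots> = shearer_q m G p A / shearer_q m G p {}"
      using shearer_q_recursion[OF Suc.prems a(1), of p] by (simp flip: sum_divide_distrib)
    finally show ?thesis .
  qed
qed

text \<open>With all probabilities scaled by \<rho> the q stay positive, so the scaled weights still
  sum to at most a constant; undoing the scaling divides by \<open>\<rho> ^ N\<close>. Both
  constants are uniform in the rule, the start state and \<open>N\<close>.\<close>

lemma obeying_words_decay:
  fixes p :: "nat \<Rightarrow> real"
  assumes irr: "\<And>i. {i} \<notin> G" and p: "\<And>j. j \<in> {1..m} \<Longrightarrow> p j \<ge> 0"
    and q: "\<And>I. I \<in> independent_sets m G \<Longrightarrow> shearer_q m G p I > 0"
  obtains \<rho> C where "\<rho> > 1" "C > 0"
    "\<And>pick upd (s :: 's) N. (\<Sum>w\<in>obeying_words m G pick upd s N. prod_list (map p w)) \<le> C / \<rho> ^ N"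
proof -
  let ?I = "independent_sets m G"
  obtain \<rho> where l: "\<rho> > 1" and ql: "\<And>I. I \<in> ?I \<Longrightarrow> shearer_q m G (\<lambda>j. \<rho> * p j) I > 0"
    using shearer_q_scale_pos[OF q] by blast
  define C where "C = (\<Sum>A\<in>?I. shearer_q m G (\<lambda>j. \<rho> * p j) A / shearer_q m G (\<lambda>j. \<rho> * p j) {})"
  have e: "{} \<in> ?I" by (simp add: independent_sets_def)
  have C: "C > 0"
    unfolding C_def using e by (intro sum_pos finite_independent_sets divide_pos_pos ql) auto
  have scale: "prod_list (map (\<lambda>j. \<rho> * p j) w) = \<rho> ^ length w * prod_list (map p w)" for w
    by (induction w) auto
  have "(\<Sum>w\<in>obeying_words m G pick upd s N. prod_list (map p w)) \<le> C / \<rho> ^ N"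
    for s N and pick :: "'s \<Rightarrow> nat set \<Rightarrow> nat" and upd :: "'s \<Rightarrow> nat \<Rightarrow> 's"
  proof -
    let ?W = "obeying_words m G pick upd s N"
    have "\<rho> ^ N * (\<Sum>w\<in>?W. prod_list (map p w)) = (\<Sum>w\<in>?W. prod_list (map (\<lambda>j. \<rho> * p j) w))"
      unfolding scale sum_distrib_left by (intro sum.cong) (auto simp: obeying_words_def)
    also have "\<dots> = (\<Sum>A\<in>?I. \<Sum>w | w \<in> ?W \<and> mins G w = A. prod_list (map (\<lambda>j. \<rho> * p j) w))"
    proof (rule sum.group[symmetric])
      show "mins G ` ?W \<subseteq> ?I"
        using mins_independent[OF irr] by (auto simp: obeying_words_def)
    qed (rule finite_obeying_words finite_independent_sets)+
    also have "\<dots> \<le> C"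
      unfolding C_def using p l by (intro sum_mono obeying_words_mins_le irr ql) auto
    finally show ?thesis
      using l by (simp add: field_simps)
  qed
  with l C that show thesis by blast
qed


section \<open>Resampling a scope\<close>

lemma prob_space_var_space:
  assumes "\<And>i. i \<in> {1..l} \<Longrightarrow> prob_space (M i)"
  shows "prob_space (var_space l M)"
  unfolding var_space_def using assms by (rule prob_space_PiM)

lemma override_on_space:
  assumes "C \<subseteq> {1..l}" "\<alpha> \<in> space (var_space l M)" "\<beta> \<in> space (var_space l M)"
  shows "override_on \<alpha> \<beta> C \<in> space (var_space l M)"
  using assms by (auto simp: var_space_def space_PiM override_on_def PiE_iff extensional_def)

lemma measurable_override_on:
  assumes "f \<in> measurable N (var_space l M)" "g \<in> measurable N (var_space l M)" "C \<subseteq> {1..l}"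
  shows "(\<lambda>x. override_on (f x) (g x) C) \<in> measurable N (var_space l M)"
  unfolding var_space_def
proof (rule measurable_PiM_single')
  show "(\<lambda>x. override_on (f x) (g x) C i) \<in> measurable N (M i)" if "i \<in> {1..l}" for i
    using measurable_compose[OF assms(1)[unfolded var_space_def] measurable_component_singleton[OF that]]
      measurable_compose[OF assms(2)[unfolded var_space_def] measurable_component_singleton[OF that]]
    by (cases "i \<in> C") simp_all
  have "override_on (f x) (g x) C \<in> space (var_space l M)" if "x \<in> space N" for x
    using assms that by (intro override_on_space) (auto dest: measurable_space)
  then show "(\<lambda>x. override_on (f x) (g x) C) \<in> space N \<rightarrow> (\<Pi>\<^sub>E i\<in>{1..l}. space (M i))"
    by (auto simp: var_space_def space_PiM)
qed

text \<open>Split an assignment into its coordinates \<open>u\<close> in \<open>C\<close> and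
  \<open>v\<close> outside. Membership in \<open>A\<close> depends on \<open>u\<close> only, and
  resampling replaces \<open>u\<close> by a fresh copy, so conditioning on \<open>A\<close> leaves
  no trace in the new assignment.\<close>

lemma nn_integral_override_on:
  fixes M :: "nat \<Rightarrow> 'a measure"
  assumes prob: "\<And>i. i \<in> {1..l} \<Longrightarrow> prob_space (M i)"
    and C: "C \<subseteq> {1..l}" and A: "A \<in> sets (var_space l M)" "determined_by (var_space l M) A C"
    and f: "f \<in> borel_measurable (var_space l M)"
  shows "(\<integral>\<^sup>+\<alpha>. indicator A \<alpha> * (\<integral>\<^sup>+\<beta>. f (override_on \<alpha> \<beta> C) \<partial>var_space l M) \<partial>var_space l M)
    = emeasure (var_space l M) A * (\<integral>\<^sup>+\<alpha>. f \<alpha> \<partial>var_space l M)"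
proof -
  \<comment> \<open>The library's product locales ask for probability spaces at all indices, not only in \<open>{1..l}\<close>.\<close>
  define M' where "M' i = (if i \<in> {1..l} then M i else return (count_space UNIV) undefined)" for i
  have "prob_space (M' i)" for i
    using prob by (auto simp: M'_def intro: prob_space_return)
  then interpret product_prob_space M' "UNIV :: nat set"
    by (rule product_prob_spaceI)
  define D where "D = {1..l} - C"
  have DC: "D \<inter> C = {}" "D \<union> C = {1..l}" "finite D" "finite C"
    using C by (auto simp: D_def intro: finite_subset)
  let ?S = "var_space l M"
  let ?U = "Pi\<^sub>M C M'" and ?V = "Pi\<^sub>M D M'"
  have S: "?S = Pi\<^sub>M (D \<union> C) M'"
    unfolding DC var_space_def by (rule PiM_cong) (auto simp: M'_def)
  interpret U: prob_space ?U
    by (rule prob_space_PiM) (rule prob_space)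
  interpret V: prob_space ?V
    by (rule prob_space_PiM) (rule prob_space)
  let ?m = "merge D C"
  have ms: "?m (v, u) \<in> space ?S" if "v \<in> space ?V" "u \<in> space ?U" for v u
    using measurable_space[OF measurable_merge, of "(v, u)" D M' C] that unfolding S
    by (simp add: space_pair_measure)
  have mm: "(\<lambda>u. ?m (v, u)) \<in> measurable ?U ?S" if "v \<in> space ?V" for v
    unfolding S using that by measurable
  have fold: "integral\<^sup>N ?S g = (\<integral>\<^sup>+v. (\<integral>\<^sup>+u. g (?m (v, u)) \<partial>?U) \<partial>?V)"
    if "g \<in> borel_measurable ?S" for g
    unfolding S using that DC by (intro product_nn_integral_fold) (simp_all add: S)
  define F where "F v = (\<integral>\<^sup>+u. f (?m (v, u)) \<partial>?U)" for v
  interpret Sp: prob_space ?S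
    using prob by (rule prob_space_var_space)
  obtain v0 where v0: "v0 \<in> space ?V"
    using V.not_empty by blast
  \<comment> \<open>Membership in \<open>A\<close> ignores \<open>v\<close>, so any fixed
    \<open>v0\<close> may stand in for it; \<kappa> turns out to be the probability of
    \<open>A\<close>.\<close>
  define \<kappa> where "\<kappa> = (\<integral>\<^sup>+u. indicator A (?m (v0, u)) \<partial>?U)"
  have ind: "indicator A (?m (v, u)) = (indicator A (?m (v0, u)) :: ennreal)"
    if "v \<in> space ?V" "u \<in> space ?U" for v u
  proof -
    have "\<forall>i\<in>C. ?m (v, u) i = ?m (v0, u) i"
      using DC by simp
    then have "?m (v, u) \<in> A \<longleftrightarrow> ?m (v0, u) \<in> A"
      using A(2)[unfolded determined_by_def, rule_format, OF ms[OF that] ms[OF v0 that(2)]] by blast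
    then show ?thesis
      by (simp add: indicator_def)
  qed
  have over: "(\<integral>\<^sup>+\<beta>. f (override_on (?m (v, u)) \<beta> C) \<partial>?S) = F v"
    if v: "v \<in> space ?V" and u: "u \<in> space ?U" for v u
  proof -
    have "(\<lambda>\<beta>. f (override_on (?m (v, u)) \<beta> C)) \<in> borel_measurable ?S"
      using ms[OF v u] C
      by (intro measurable_compose[OF _ f] measurable_override_on) auto
    then have "(\<integral>\<^sup>+\<beta>. f (override_on (?m (v, u)) \<beta> C) \<partial>?S) =
        (\<integral>\<^sup>+v'. (\<integral>\<^sup>+u'. f (override_on (?m (v, u)) (?m (v', u')) C) \<partial>?U) \<partial>?V)"
      by (rule fold)
    also have "\<dots> = (\<integral>\<^sup>+v'. F v \<partial>?V)"
    proof -
      \<comment> \<open>Overriding all of \<open>C\<close> discards \<open>u\<close> and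
        \<open>v'\<close>, so the integrand is constant in \<open>v'\<close>.\<close>
      have "override_on (?m (v, u)) (?m (v', u')) C = ?m (v, u')" for v' u'
        using DC by (auto simp: override_on_def merge_def fun_eq_iff)
      then show ?thesis by (simp add: F_def)
    qed
    finally show ?thesis
      by (simp add: V.emeasure_space_1)
  qed
  have Fm: "F \<in> borel_measurable ?V"
  proof -
    have "(\<lambda>x. f (?m x)) \<in> borel_measurable (?V \<Otimes>\<^sub>M ?U)"
      using f unfolding S by measurable
    then show ?thesis
      unfolding F_def by (intro U.borel_measurable_nn_integral) (simp add: case_prod_eta)
  qed
  have key: "(\<integral>\<^sup>+\<alpha>. indicator A \<alpha> * (\<integral>\<^sup>+\<beta>. f (override_on \<alpha> \<beta> C) \<partial>?S) \<partial>?S) = \<kappa> * (\<integral>\<^sup>+v. F v \<partial>?V)"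
  proof -
    have "(\<lambda>(\<alpha>, \<beta>). f (override_on \<alpha> \<beta> C)) \<in> borel_measurable (?S \<Otimes>\<^sub>M ?S)"
      unfolding split_beta using C
      by (intro measurable_compose[OF _ f] measurable_override_on measurable_fst measurable_snd)
    then have "(\<lambda>\<alpha>. \<integral>\<^sup>+\<beta>. f (override_on \<alpha> \<beta> C) \<partial>?S) \<in> borel_measurable ?S"
      by (rule Sp.borel_measurable_nn_integral)
    then have "(\<lambda>\<alpha>. indicator A \<alpha> * (\<integral>\<^sup>+\<beta>. f (override_on \<alpha> \<beta> C) \<partial>?S)) \<in> borel_measurable ?S"
      using A(1) by simp
    then have "(\<integral>\<^sup>+\<alpha>. indicator A \<alpha> * (\<integral>\<^sup>+\<beta>. f (override_on \<alpha> \<beta> C) \<partial>?S) \<partial>?S) =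
        (\<integral>\<^sup>+v. (\<integral>\<^sup>+u. indicator A (?m (v, u)) * (\<integral>\<^sup>+\<beta>. f (override_on (?m (v, u)) \<beta> C) \<partial>?S) \<partial>?U) \<partial>?V)"
      by (rule fold)
    also have "\<dots> = (\<integral>\<^sup>+v. (\<integral>\<^sup>+u. indicator A (?m (v0, u)) * F v \<partial>?U) \<partial>?V)"
      by (intro nn_integral_cong) (simp add: over, simp add: ind)
    also have "\<dots> = (\<integral>\<^sup>+v. \<kappa> * F v \<partial>?V)"
      unfolding \<kappa>_def
      by (intro nn_integral_cong nn_integral_multc measurable_compose[OF mm[OF v0]]
          borel_measurable_indicator A(1))
    also have "\<dots> = \<kappa> * (\<integral>\<^sup>+v. F v \<partial>?V)"
      using Fm by (rule nn_integral_cmult)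
    finally show ?thesis .
  qed
  have "emeasure ?S A = (\<integral>\<^sup>+\<alpha>. indicator A \<alpha> \<partial>?S)"
    using A(1) by simp
  also have "\<dots> = (\<integral>\<^sup>+v. (\<integral>\<^sup>+u. indicator A (?m (v, u)) \<partial>?U) \<partial>?V)"
    using A(1) by (intro fold) simp
  also have "\<dots> = (\<integral>\<^sup>+v. \<kappa> \<partial>?V)"
    unfolding \<kappa>_def by (intro nn_integral_cong) (simp add: ind)
  finally have "emeasure ?S A = \<kappa>"
    by (simp add: V.emeasure_space_1)
  moreover have "(\<integral>\<^sup>+\<alpha>. f \<alpha> \<partial>?S) = (\<integral>\<^sup>+v. F v \<partial>?V)"
    unfolding F_def using f by (rule fold)
  ultimately show ?thesis
    using key by simp
qed


section \<open>The probability of a resampling sequence\<close>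

text \<open>Each event is only required to occur just before it is resampled; the order the
  algorithm would choose is ignored, which makes the product formula exact. Here
  \<open>\<omega> 0\<close> serves the first resampling, the initial assignment being the separate
  argument \<alpha>.\<close>

fun valid ::
  "(nat \<Rightarrow> (nat \<Rightarrow> 'a) set) \<Rightarrow> (nat \<Rightarrow> nat set) \<Rightarrow> nat list \<Rightarrow> (nat \<Rightarrow> 'a) \<Rightarrow> (nat \<Rightarrow> nat \<Rightarrow> 'a) \<Rightarrow> bool" where
  "valid E sc [] \<alpha> \<omega> \<longleftrightarrow> True"
| "valid E sc (a # w) \<alpha> \<omega> \<longleftrightarrow>
     \<alpha> \<in> E a \<and> valid E sc w (override_on \<alpha> (\<omega> 0) (sc a)) (\<lambda>i. \<omega> (Suc i))"

text \<open>An independent sequence is its first sample followed by an independent copy of itself;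
  Fubini then integrates that sample separately.\<close>

lemma nn_integral_sample_space:
  assumes prob: "\<And>i. i \<in> {1..l} \<Longrightarrow> prob_space (M i)"
    and f: "f \<in> borel_measurable (sample_space l M)"
  shows "(\<integral>\<^sup>+\<omega>. f \<omega> \<partial>sample_space l M) =
    (\<integral>\<^sup>+\<alpha>. (\<integral>\<^sup>+\<omega>. f (case_nat \<alpha> \<omega>) \<partial>sample_space l M) \<partial>var_space l M)"
proof -
  let ?S = "var_space l M" and ?W = "sample_space l M"
  interpret V: prob_space ?S
    using prob by (rule prob_space_var_space)
  interpret sequence_space ?S
    by unfold_locales
  interpret W: prob_space ?W
    unfolding sample_space_def by (rule prob_space_PiM) (rule V.prob_space_axioms)
  have m: "(\<lambda>(s, \<omega>). case_nat s \<omega>) \<in> measurable (?S \<Otimes>\<^sub>M ?W) ?W"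
    unfolding sample_space_def by measurable
  have d: "distr (?S \<Otimes>\<^sub>M ?W) ?W (\<lambda>(s, \<omega>). case_nat s \<omega>) = ?W"
    unfolding sample_space_def by (rule PiM_iter)
  have "(\<integral>\<^sup>+\<omega>. f \<omega> \<partial>?W) = (\<integral>\<^sup>+x. f (case x of (s, \<omega>) \<Rightarrow> case_nat s \<omega>) \<partial>(?S \<Otimes>\<^sub>M ?W))"
    using nn_integral_distr[OF m, of f] f by (simp add: d)
  also have "\<dots> = (\<integral>\<^sup>+\<alpha>. (\<integral>\<^sup>+\<omega>. f (case_nat \<alpha> \<omega>) \<partial>?W) \<partial>?S)"
    using measurable_compose[OF m f] by (subst W.nn_integral_fst[symmetric]) simp_all
  finally show ?thesis .
qed

context
  fixes l m :: nat and M :: "nat \<Rightarrow> 'a measure"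
    and E :: "nat \<Rightarrow> (nat \<Rightarrow> 'a) set" and sc :: "nat \<Rightarrow> nat set"
  assumes prob: "\<And>i. i \<in> {1..l} \<Longrightarrow> prob_space (M i)"
    and sc: "\<And>j. j \<in> {1..m} \<Longrightarrow> sc j \<subseteq> {1..l}"
    and E: "\<And>j. j \<in> {1..m} \<Longrightarrow> E j \<in> sets (var_space l M)"
    and det: "\<And>j. j \<in> {1..m} \<Longrightarrow> determined_by (var_space l M) (E j) (sc j)"
begin

text \<open>Keeping \<open>f\<close> and \<open>g\<close> general lets the induction pass to the
  overridden assignment and the shifted sequence.\<close>

lemma measurable_valid:
  assumes "set w \<subseteq> {1..m}"
    and "f \<in> measurable N (var_space l M)" "g \<in> measurable N (sample_space l M)"
  shows "Measurable.pred N (\<lambda>x. valid E sc w (f x) (g x))"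
  using assms
proof (induction w arbitrary: f g)
  case (Cons a w)
  have a: "a \<in> {1..m}" using Cons.prems(1) by simp
  have g: "(\<lambda>x. g x i) \<in> measurable N (var_space l M)" for i
    using Cons.prems(3) unfolding sample_space_def by measurable
  have g': "(\<lambda>x i. g x (Suc i)) \<in> measurable N (sample_space l M)"
    unfolding sample_space_def by (rule measurable_PiM_single') (use g in \<open>auto dest: measurable_space\<close>)
  have "Measurable.pred N (\<lambda>x. f x \<in> E a)"
    using E[OF a] Cons.prems(2) by measurable
  moreover have "Measurable.pred N
      (\<lambda>x. valid E sc w (override_on (f x) (g x 0) (sc a)) (\<lambda>i. g x (Suc i)))"
    using Cons.prems sc[OF a] g g' by (intro Cons.IH measurable_override_on) auto
  ultimately show ?case
    by (simp add: pred_intros_logic)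
qed simp

text \<open>Each letter contributes its probability and hands the product distribution on to the
  next. This is why \<alpha> is averaged as well: for a fixed \<alpha> the induction would not
  close.\<close>

lemma nn_integral_valid:
  assumes "set w \<subseteq> {1..m}"
  shows "(\<integral>\<^sup>+\<alpha>. (\<integral>\<^sup>+\<omega>. indicator {\<omega>. valid E sc w \<alpha> \<omega>} \<omega> \<partial>sample_space l M) \<partial>var_space l M)
    = prod_list (map (\<lambda>j. emeasure (var_space l M) (E j)) w)"
  using assms
proof (induction w)
  case Nil
  interpret V: prob_space "var_space l M"
    using prob by (rule prob_space_var_space)
  interpret W: prob_space "sample_space l M"
    unfolding sample_space_def by (rule prob_space_PiM) (rule V.prob_space_axioms)
  show ?case
    by (simp add: V.emeasure_space_1 W.emeasure_space_1)
next
  case (Cons a w)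
  let ?S = "var_space l M" and ?W = "sample_space l M"
  interpret V: prob_space ?S
    using prob by (rule prob_space_var_space)
  interpret W: prob_space ?W
    unfolding sample_space_def by (rule prob_space_PiM) (rule V.prob_space_axioms)
  have a: "a \<in> {1..m}" using Cons.prems by simp
  have indm: "(\<lambda>x. indicator {\<omega>. valid E sc v (f x) \<omega>} (g x) :: ennreal) \<in> borel_measurable N"
    if "set v \<subseteq> {1..m}" "f \<in> measurable N ?S" "g \<in> measurable N ?W" for v f g and N :: "'b measure"
  proof -
    have "(\<lambda>x. indicator {\<omega>. valid E sc v (f x) \<omega>} (g x) :: ennreal) =
        indicator {x. valid E sc v (f x) (g x)}"
      by (auto simp: indicator_def fun_eq_iff)
    then show ?thesis
      using measurable_valid[OF that] by (simp add: borel_measurable_indicator_iff pred_def Int_def conj_commute)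
  qed
  define F where "F \<alpha> = (\<integral>\<^sup>+\<omega>. indicator {\<omega>. valid E sc w \<alpha> \<omega>} \<omega> \<partial>?W)" for \<alpha>
  have "(\<lambda>(\<alpha>, \<omega>). indicator {\<omega>. valid E sc w \<alpha> \<omega>} \<omega> :: ennreal) \<in> borel_measurable (?S \<Otimes>\<^sub>M ?W)"
    unfolding split_beta using Cons.prems by (intro indm) auto
  then have Fm: "F \<in> borel_measurable ?S"
    unfolding F_def by (rule W.borel_measurable_nn_integral)
  have "(\<integral>\<^sup>+\<omega>. indicator {\<omega>. valid E sc (a # w) \<alpha> \<omega>} \<omega> \<partial>?W) =
      indicator (E a) \<alpha> * (\<integral>\<^sup>+\<beta>. F (override_on \<alpha> \<beta> (sc a)) \<partial>?S)" if "\<alpha> \<in> space ?S" for \<alpha>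
  proof -
    have "(\<integral>\<^sup>+\<omega>. indicator {\<omega>. valid E sc (a # w) \<alpha> \<omega>} \<omega> \<partial>?W) =
        (\<integral>\<^sup>+\<beta>. (\<integral>\<^sup>+\<omega>. indicator {\<omega>. valid E sc (a # w) \<alpha> \<omega>} (case_nat \<beta> \<omega>) \<partial>?W) \<partial>?S)"
      using that Cons.prems by (intro nn_integral_sample_space prob indm) auto
    also have "\<dots> = (\<integral>\<^sup>+\<beta>. (\<integral>\<^sup>+\<omega>. indicator (E a) \<alpha> *
        indicator {\<omega>. valid E sc w (override_on \<alpha> \<beta> (sc a)) \<omega>} \<omega> \<partial>?W) \<partial>?S)"
      by (intro nn_integral_cong) (auto simp: indicator_def)
    also have "\<dots> = (\<integral>\<^sup>+\<beta>. indicator (E a) \<alpha> * F (override_on \<alpha> \<beta> (sc a)) \<partial>?S)"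
      unfolding F_def using that Cons.prems sc[OF a]
      by (intro nn_integral_cong nn_integral_cmult indm) (auto intro!: measurable_const override_on_space)
    also have "\<dots> = indicator (E a) \<alpha> * (\<integral>\<^sup>+\<beta>. F (override_on \<alpha> \<beta> (sc a)) \<partial>?S)"
      using that sc[OF a]
      by (intro nn_integral_cmult measurable_compose[OF _ Fm] measurable_override_on) auto
    finally show ?thesis .
  qed
  then have "(\<integral>\<^sup>+\<alpha>. (\<integral>\<^sup>+\<omega>. indicator {\<omega>. valid E sc (a # w) \<alpha> \<omega>} \<omega> \<partial>?W) \<partial>?S) =
      (\<integral>\<^sup>+\<alpha>. indicator (E a) \<alpha> * (\<integral>\<^sup>+\<beta>. F (override_on \<alpha> \<beta> (sc a)) \<partial>?S) \<partial>?S)"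
    by (intro nn_integral_cong) simp
  also have "\<dots> = emeasure ?S (E a) * (\<integral>\<^sup>+\<alpha>. F \<alpha> \<partial>?S)"
    by (rule nn_integral_override_on[OF prob sc[OF a] E[OF a] det[OF a] Fm])
  finally show ?case
    using Cons by (simp add: F_def)
qed

text \<open>Splitting off \<open>\<omega> 0\<close> supplies the random initial assignment.\<close>

lemma measure_valid:
  assumes "set w \<subseteq> {1..m}"
  defines "V \<equiv> {\<omega> \<in> space (sample_space l M). valid E sc w (\<omega> 0) (\<lambda>i. \<omega> (Suc i))}"
  shows "V \<in> sets (sample_space l M)"
    and "measure (sample_space l M) V = prod_list (map (\<lambda>j. measure (var_space l M) (E j)) w)"
proof -
  let ?S = "var_space l M" and ?W = "sample_space l M"
  interpret S: prob_space ?S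
    using prob by (rule prob_space_var_space)
  have c: "(\<lambda>\<omega>. \<omega> i) \<in> measurable ?W ?S" for i
    unfolding sample_space_def by measurable
  have c': "(\<lambda>\<omega> i. \<omega> (Suc i)) \<in> measurable ?W ?W"
    by (subst (2) sample_space_def, rule measurable_PiM_single') (use c in \<open>auto dest: measurable_space\<close>)
  show V: "V \<in> sets ?W"
    unfolding V_def using measurable_valid[OF assms(1) c c'] by (simp add: pred_def)
  have "emeasure ?W V = (\<integral>\<^sup>+\<omega>. indicator V \<omega> \<partial>?W)"
    using V by simp
  also have "\<dots> = (\<integral>\<^sup>+\<alpha>. (\<integral>\<^sup>+\<omega>. indicator V (case_nat \<alpha> \<omega>) \<partial>?W) \<partial>?S)"
    using V by (intro nn_integral_sample_space prob) auto
  also have "\<dots> = (\<integral>\<^sup>+\<alpha>. (\<integral>\<^sup>+\<omega>. indicator {\<omega>. valid E sc w \<alpha> \<omega>} \<omega> \<partial>?W) \<partial>?S)"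
    by (intro nn_integral_cong)
      (auto simp: V_def indicator_def sample_space_def space_PiM PiE_iff split: nat.splits)
  also have "\<dots> = prod_list (map (\<lambda>j. emeasure ?S (E j)) w)"
    by (rule nn_integral_valid[OF assms(1)])
  also have "\<dots> = ennreal (prod_list (map (\<lambda>j. measure ?S (E j)) w))"
    by (induction w) (simp_all add: S.emeasure_eq_measure ennreal_mult' prod_list_nonneg)
  finally have "emeasure ?W V = ennreal (prod_list (map (\<lambda>j. measure ?S (E j)) w))" .
  then show "measure ?W V = prod_list (map (\<lambda>j. measure ?S (E j)) w)"
    by (auto simp: measure_def intro!: enn2real_ennreal prod_list_nonneg)
qed

end


section \<open>Executions of the algorithm\<close>

text \<open>
  A state \<open>(I, j)\<close> records the current set \<open>I\<^sub>t\<close> and the event resampled last. \<open>msr_pick\<close> and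
  \<open>msr_upd\<close> merge the tests of step (2) with the choice of the next event; in case (b) they add that
  event to the new set \<open>{j}\<close>. Before the first resampling the state is \<open>({}, 0)\<close>, \<open>0\<close> not being an
  index.
\<close>

definition msr_pick :: "nat set set \<Rightarrow> nat set \<times> nat \<Rightarrow> nat set \<Rightarrow> nat" where
  "msr_pick G s A = (case s of (I, j) \<Rightarrow>
     if j \<in> A then j
     else if A - (I \<union> nbrs_set G I) \<noteq> {} then Min (A - (I \<union> nbrs_set G I))
     else if A - nbrs G j \<noteq> {} then Min (A - nbrs G j)
     else Min A)"

definition msr_upd :: "nat set set \<Rightarrow> nat set \<times> nat \<Rightarrow> nat \<Rightarrow> nat set \<times> nat" where
  "msr_upd G s a = (case s of (I, j) \<Rightarrow>
     if a = j then s
     else if a \<notin> I \<union> nbrs_set G I then (insert a I, a)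
     else if a \<notin> nbrs G j then ({j, a}, a)
     else ({a}, a))"

context
  fixes l m :: nat and M :: "nat \<Rightarrow> 'a measure"
    and E :: "nat \<Rightarrow> (nat \<Rightarrow> 'a) set" and sc :: "nat \<Rightarrow> nat set" and G :: "nat set set"
  assumes sc: "\<And>j. j \<in> {1..m} \<Longrightarrow> sc j \<subseteq> {1..l}"
    and G: "G = d_dep_graph (var_space l M) m E sc"
begin

lemma d_dep_graph_irrefl: "{i} \<notin> G"
  unfolding G d_dep_graph_def by (auto simp: doubleton_eq_iff)

text \<open>An event created while \<open>E j\<close> ceases, with changes confined to
  \<open>sc j\<close>, is literally a witness of d-dependency on \<open>E j\<close>, hence a
  neighbour of \<open>j\<close>.\<close>

lemma occurring_after_resampling:
  assumes j: "j \<in> {1..m}" and sp: "\<alpha> \<in> space (var_space l M)" "\<beta> \<in> space (var_space l M)"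
    and agree: "\<And>i. i \<notin> sc j \<Longrightarrow> \<beta> i = \<alpha> i" and "\<alpha> \<in> E j" "\<beta> \<notin> E j"
  shows "occurring m E \<beta> - nbrs G j \<subseteq> occurring m E \<alpha>"
proof
  fix i assume i: "i \<in> occurring m E \<beta> - nbrs G j"
  show "i \<in> occurring m E \<alpha>"
  proof (rule ccontr)
    assume "i \<notin> occurring m E \<alpha>"
    with i have "i \<in> {1..m}" "\<beta> \<in> E i" "\<alpha> \<notin> E i"
      by (auto simp: occurring_def)
    then have "d_dependent (var_space l M) (E i) (E j) (sc j)" "i \<noteq> j"
      unfolding d_dependent_def using assms by blast+
    then have "{i, j} \<in> G"
      unfolding G d_dep_graph_def using \<open>i \<in> {1..m}\<close> j by blast
    with i show False by (simp add: nbrs_def)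
  qed
qed

text \<open>
  The point is that the minimal letters of the word still to be resampled occur already: resampling
  non-neighbours until they cease cannot create an event, by d-dependency. In the middle of an inner
  loop this refers to the assignment \<open>\<alpha>\<close> at which the loop started, as \<open>asg s\<close> is then an arbitrary
  intermediate assignment.
\<close>

definition follows :: "'a msr_state \<Rightarrow> nat list \<Rightarrow> bool" where
  "follows s w \<longleftrightarrow> w = [] \<or>
    (let A = mins G w; I = isets s (phase s) in
     case ctrl s of
       Outer \<Rightarrow> A \<subseteq> occurring m E (asg s) \<and> A - (I \<union> nbrs_set G I) \<noteq> {} \<and>
         hd w = Min (A - (I \<union> nbrs_set G I)) \<and>
         obeys G (msr_pick G) (msr_upd G) (insert (hd w) I, hd w) (tl w)
     | Inner j c \<Rightarrow> obeys G (msr_pick G) (msr_upd G) (I, j) w \<and>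
         (asg s \<in> E j \<longrightarrow> hd w = j) \<and>
         (\<forall>\<alpha>\<in>space (var_space l M). \<alpha> \<in> E j \<longrightarrow> (\<forall>i. i \<notin> sc j \<longrightarrow> asg s i = \<alpha> i) \<longrightarrow>
            A - nbrs G j \<subseteq> occurring m E \<alpha>)
     | Stopped \<Rightarrow> False)"

text \<open>The algorithm minimises over all occurring candidates, the word rule only over minimal
  letters. Both choices agree once the algorithm's choice is such a letter.\<close>

lemma Min_subset_eq:
  assumes "finite B" "A \<subseteq> B" "Min B \<in> A"
  shows "Min A = (Min B :: 'b :: linorder)"
  using assms by (intro Min_eqI) (auto intro: finite_subset Min_le)

lemma finite_occurring: "finite (occurring m E \<alpha>)"
  by (simp add: occurring_def)

text \<open>At the exit of an inner loop the cases (a), (b), (c) match the last three branches of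
  \<open>msr_pick\<close> and \<open>msr_upd\<close>. Each test on occurring events can be repeated
  on the minimal letters, as these occur and include the next event.\<close>

lemma obeys_after_inner:
  assumes w: "w \<noteq> []" and j: "asg s \<notin> E j" and c: "ctrl s = Inner j c"
    and f: "follows (msr_step m E sc G \<omega> s) w"
  shows "mins G w \<subseteq> occurring m E (asg s)"
    and "obeys G (msr_pick G) (msr_upd G) (isets s (phase s), j) w"
proof -
  let ?I = "isets s (phase s)" and ?O = "occurring m E (asg s)"
  let ?K = "?O - (?I \<union> nbrs_set G ?I)"
  define A where "A = mins G w"
  obtain a v where wv: "w = a # v" using w by (cases w) auto
  have K: "candidates m E G s = ?K"
    by (simp add: candidates_def Let_def)
  have jO: "j \<notin> ?O" using j by (simp add: occurring_def)
  have step: "msr_step m E sc G \<omega> s =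
     (if ?K \<noteq> {} then s\<lparr>ctrl := Outer\<rparr>
      else if \<not> ?O \<subseteq> nbrs G j then
        s\<lparr>phase := phase s + 1, isets := (isets s)(phase s + 1 := {j}), ctrl := Outer\<rparr>
      else
        s\<lparr>phase := phase s + c + 1,
          isets := (\<lambda>u. if u \<in> {phase s + 1..phase s + c} then {j} else if u = phase s + c + 1 then {} else isets s u),
          ctrl := Outer\<rparr>)"
    using j c by (simp add: msr_step_def K Let_def)
  \<comment> \<open>This is the set at the new current phase. In case (c) the sets
    \<open>{j}\<close> belong to completed phases, and the current one is empty.\<close>
  define I' where "I' = (if ?K \<noteq> {} then ?I else if \<not> ?O \<subseteq> nbrs G j then {j} else {})"
  have *: "A \<subseteq> ?O" "A - (I' \<union> nbrs_set G I') \<noteq> {}" "Min (A - (I' \<union> nbrs_set G I')) = a"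
    "obeys G (msr_pick G) (msr_upd G) (insert a I', a) v"
    using f unfolding follows_def step I'_def A_def by (simp_all add: wv Let_def split: if_splits)
  show "mins G w \<subseteq> ?O" using *(1) by (simp add: A_def)
  have finA: "finite A"
    using *(1) finite_occurring by (rule finite_subset)
  have aA: "a \<in> A - (I' \<union> nbrs_set G I')"
    using Min_in[OF _ *(2)] finA unfolding *(3) by simp
  have jA: "j \<notin> A" "a \<noteq> j"
    using jO *(1) aA by auto
  have nj: "nbrs_set G {j} = nbrs G j" "nbrs_set G {} = {}"
    by (auto simp: nbrs_set_def)
  have "msr_pick G (?I, j) A = a \<and> msr_upd G (?I, j) a = (insert a I', a)"
  proof (cases "?K = {}")
    case False
    then show ?thesis
      using *(2,3) aA jA by (simp add: I'_def msr_pick_def msr_upd_def)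
  next
    case True
    then have AK: "A - (?I \<union> nbrs_set G ?I) = {}" using *(1) by blast
    then have a1: "\<not> a \<notin> ?I \<union> nbrs_set G ?I" using aA by blast
    show ?thesis
    proof (cases "?O \<subseteq> nbrs G j")
      case False
      then have I': "I' = {j}" using True by (simp add: I'_def)
      have "A - (I' \<union> nbrs_set G I') = A - nbrs G j"
        using jA I' nj by auto
      then show ?thesis
        using * aA jA AK a1 I' unfolding msr_pick_def msr_upd_def
        by (simp only: prod.case if_False if_True simp_thms not_not insert_commute) auto
    next
      case sub: True
      then have I': "I' = {}" using True by (simp add: I'_def)
      have "A - nbrs G j = {}" "a \<in> nbrs G j" "Min A = a"
        using sub *(1,3) aA I' nj by auto
      then show ?thesis
        using jA AK a1 I' unfolding msr_pick_def msr_upd_def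
        by (simp only: prod.case if_False if_True simp_thms not_not)
    qed
  qed
  with *(4) show "obeys G (msr_pick G) (msr_upd G) (?I, j) w"
    unfolding A_def wv by simp
qed

text \<open>Induction on the number of steps, peeling off the first one, builds the word from its
  end: what \<open>follows\<close> says after a step is carried back to the state before it, and
  only resampling steps prepend a letter.\<close>

lemma msr_step_follows:
  assumes w: "\<omega> \<in> UNIV \<rightarrow> space (var_space l M)" and s: "asg s \<in> space (var_space l M)"
    and c: "\<And>j c. ctrl s = Inner j c \<Longrightarrow> j \<in> {1..m}"
    and dr: "drawn s + N \<le> drawn ((msr_step m E sc G \<omega> ^^ k) s)"
  shows "\<exists>w. length w = N \<and> set w \<subseteq> {1..m} \<and> valid E sc w (asg s) (\<lambda>i. \<omega> (drawn s + i)) \<and> follows s w"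
  using s c dr
proof (induction k arbitrary: s N)
  case 0
  then show ?case by (auto simp: follows_def)
next
  case (Suc k)
  let ?S = "var_space l M"
  let ?s = "msr_step m E sc G \<omega> s"
  let ?I = "isets s (phase s)" and ?O = "occurring m E (asg s)"
  let ?K = "?O - (?I \<union> nbrs_set G ?I)"
  have K: "candidates m E G s = ?K"
    by (simp add: candidates_def Let_def)
  show ?case
  \<comment> \<open>The word may end before the run does; the empty word follows from every
    state.\<close>
  proof (cases "N = 0")
    case True
    then show ?thesis by (auto simp: follows_def)
  next
    case N: False
    have dr: "drawn s + N \<le> drawn ((msr_step m E sc G \<omega> ^^ k) ?s)"
      using Suc.prems(3) by (simp add: funpow_swap1)
    show ?thesis
    proof (cases "ctrl s")
      case Stopped
      then have "?s = s" by (simp add: msr_step_def)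
      then have "\<exists>w. length w = N \<and> set w \<subseteq> {1..m} \<and> valid E sc w (asg s) (\<lambda>i. \<omega> (drawn s + i)) \<and> follows s w"
        using dr Suc.prems by (intro Suc.IH) auto
      then show ?thesis .
    next
      case Outer
      show ?thesis
      proof (cases "?K = {}")
        case True
        then have s': "?s = s\<lparr>ctrl := Stopped\<rparr>"
          using Outer by (simp add: msr_step_def K)
        have "\<exists>w. length w = N \<and> set w \<subseteq> {1..m} \<and> valid E sc w (asg ?s) (\<lambda>i. \<omega> (drawn ?s + i)) \<and> follows ?s w"
          using dr Suc.prems by (intro Suc.IH) (simp_all add: s')
        \<comment> \<open>Contradictory case: no non-empty word follows from
          \<open>Stopped\<close>.\<close>
        then show ?thesis
          using N by (auto simp: s' follows_def)
      next
        case False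
        define j where "j = Min ?K"
        have finK: "finite ?K" using finite_occurring by simp
        have jK: "j \<in> ?K" unfolding j_def using finK False by (rule Min_in)
        then have j: "j \<in> {1..m}" "asg s \<in> E j" by (auto simp: occurring_def)
        have s': "?s = s\<lparr>isets := (isets s)(phase s := insert j ?I), ctrl := Inner j 0\<rparr>"
          using Outer False by (simp add: msr_step_def K j_def Let_def)
        have "\<exists>w. length w = N \<and> set w \<subseteq> {1..m} \<and> valid E sc w (asg ?s) (\<lambda>i. \<omega> (drawn ?s + i)) \<and> follows ?s w"
          using dr Suc.prems j by (intro Suc.IH) (simp_all add: s')
        then obtain w where w: "length w = N" "set w \<subseteq> {1..m}" "valid E sc w (asg s) (\<lambda>i. \<omega> (drawn s + i))"
          and f: "follows ?s w"
          by (auto simp: s')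
        obtain a v where [simp]: "w = a # v" using w N by (cases w) auto
        \<comment> \<open>At loop entry the starting assignment is \<open>asg s\<close> itself, so
          the quantified \<alpha> of \<open>follows\<close> is taken to be
          \<open>asg s\<close>.\<close>
        have ob: "obeys G (msr_pick G) (msr_upd G) (insert j ?I, j) w"
          and aj: "a = j" and A: "mins G w - nbrs G j \<subseteq> ?O"
          using f j Suc.prems(1) by (auto simp: follows_def s' Let_def)
        have "j \<notin> nbrs G j"
          using d_dep_graph_irrefl by (simp add: nbrs_def)
        then have A': "mins G w \<subseteq> ?O" "j \<in> mins G w"
          using A aj by auto
        then have sub: "mins G w - (?I \<union> nbrs_set G ?I) \<subseteq> ?K" by blast
        have jA: "j \<in> mins G w - (?I \<union> nbrs_set G ?I)"
          using jK A' by blast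
        then have "Min (mins G w - (?I \<union> nbrs_set G ?I)) = j"
          unfolding j_def by (intro Min_subset_eq[OF finK sub]) simp
        moreover have "obeys G (msr_pick G) (msr_upd G) (insert j ?I, j) v"
          using ob aj by (simp add: msr_upd_def)
        ultimately have "follows s w"
          using A' jA aj Outer by (auto simp: follows_def Let_def)
        with w show ?thesis by blast
      qed
    next
      case (Inner j c)
      have j: "j \<in> {1..m}" using Suc.prems(2) Inner .
      show ?thesis
      proof (cases "asg s \<in> E j")
        case True
        have s': "?s = s\<lparr>asg := override_on (asg s) (\<omega> (drawn s)) (sc j), drawn := drawn s + 1,
            ctrl := Inner j (c + 1)\<rparr>"
          using Inner True by (simp add: msr_step_def Let_def)
        obtain N' where N': "N = Suc N'" using N by (cases N) auto
        have "\<exists>w. length w = N' \<and> set w \<subseteq> {1..m} \<and> valid E sc w (asg ?s) (\<lambda>i. \<omega> (drawn ?s + i)) \<and> follows ?s w"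
        proof (rule Suc.IH)
          show "asg ?s \<in> space ?S"
            using assms(1) Suc.prems(1) by (auto simp: s' intro!: override_on_space sc[OF j])
          show "drawn ?s + N' \<le> drawn ((msr_step m E sc G \<omega> ^^ k) ?s)"
            using dr N' by (simp add: s')
        qed (use j in \<open>simp add: s'\<close>)
        then obtain w where w: "length w = N'" "set w \<subseteq> {1..m}"
            "valid E sc w (override_on (asg s) (\<omega> (drawn s)) (sc j)) (\<lambda>i. \<omega> (drawn s + 1 + i))"
          and f: "follows ?s w"
          by (auto simp: s')
        have ob: "obeys G (msr_pick G) (msr_upd G) (?I, j) w"
          using f by (auto simp: follows_def s' Let_def)
        \<comment> \<open>Resampling touches only \<open>sc j\<close>, so agreement with \<alpha>
          outside that scope survives it.\<close>
        have A: "mins G w - nbrs G j \<subseteq> occurring m E \<alpha>"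
          if "\<alpha> \<in> space ?S" "\<alpha> \<in> E j" "\<forall>i. i \<notin> sc j \<longrightarrow> asg s i = \<alpha> i" for \<alpha>
          using f that by (auto simp: follows_def s' Let_def)
        have "j \<in> occurring m E \<alpha>" if "\<alpha> \<in> E j" for \<alpha>
          using that j by (simp add: occurring_def)
        then have "follows s (j # w)"
          using ob A Inner by (auto simp: follows_def Let_def msr_pick_def msr_upd_def)
        moreover have "valid E sc (j # w) (asg s) (\<lambda>i. \<omega> (drawn s + i))"
          using w True by simp
        ultimately show ?thesis
          using w N' j by (intro exI[of _ "j # w"]) simp
      next
        case False
        have s': "asg ?s = asg s" "drawn ?s = drawn s" "ctrl ?s = Outer"
          using Inner False by (simp_all add: msr_step_def Let_def)
        have "\<exists>w. length w = N \<and> set w \<subseteq> {1..m} \<and> valid E sc w (asg ?s) (\<lambda>i. \<omega> (drawn ?s + i)) \<and> follows ?s w"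
          using dr Suc.prems(1) by (intro Suc.IH) (simp_all add: s')
        then obtain w where w: "length w = N" "set w \<subseteq> {1..m}" "valid E sc w (asg s) (\<lambda>i. \<omega> (drawn s + i))"
          and f: "follows ?s w"
          by (auto simp: s')
        have wn: "w \<noteq> []" using w N by auto
        note ob = obeys_after_inner[OF wn False Inner f]
        \<comment> \<open>Only the two ends of the loop are compared: \<alpha>, where
          \<open>E j\<close> occurs, and the current assignment, where it has ceased.\<close>
        have "mins G w - nbrs G j \<subseteq> occurring m E \<alpha>"
          if "\<alpha> \<in> space ?S" "\<alpha> \<in> E j" "\<forall>i. i \<notin> sc j \<longrightarrow> asg s i = \<alpha> i" for \<alpha>
          using occurring_after_resampling[OF j that(1) Suc.prems(1) _ that(2) False] that(3) ob(1) by blast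
        then have "follows s w"
          using ob(2) False Inner by (simp add: follows_def Let_def)
        with w show ?thesis by blast
      qed
    qed
  qed
qed

text \<open>The inequality is strict because \<open>drawn\<close> starts at 1, counting the initial
  assignment. The start state makes the rule pick the least minimal letter, as the algorithm does
  with an empty set.\<close>

lemma run_obeying_word:
  assumes w: "\<omega> \<in> UNIV \<rightarrow> space (var_space l M)"
    and dr: "N < drawn (msr_run m E sc G \<omega> k)"
  obtains w where "w \<in> obeying_words m G (msr_pick G) (msr_upd G) ({}, 0) N"
    "valid E sc w (\<omega> 0) (\<lambda>i. \<omega> (Suc i))"
proof -
  let ?s = "msr_init \<omega>"
  have "\<exists>w. length w = N \<and> set w \<subseteq> {1..m} \<and> valid E sc w (asg ?s) (\<lambda>i. \<omega> (drawn ?s + i)) \<and> follows ?s w"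
    using dr w by (intro msr_step_follows[where k = k]) (auto simp: msr_init_def msr_run_def)
  then obtain w where w: "length w = N" "set w \<subseteq> {1..m}" "valid E sc w (\<omega> 0) (\<lambda>i. \<omega> (Suc i))"
    and f: "follows ?s w"
    by (auto simp: msr_init_def)
  have "obeys G (msr_pick G) (msr_upd G) ({}, 0) w"
  proof (cases w)
    case (Cons a v)
    have A: "0 \<notin> mins G w" "a \<noteq> 0"
      using f Cons by (auto simp: follows_def msr_init_def occurring_def Let_def)
    have n: "nbrs_set G {} = {}" by (simp add: nbrs_set_def)
    have "a = Min (mins G w)" "mins G w \<noteq> {}" "obeys G (msr_pick G) (msr_upd G) ({a}, a) v"
      using f Cons by (simp_all add: follows_def msr_init_def Let_def n)
    then show ?thesis
      using A Cons by (simp add: msr_pick_def msr_upd_def n)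
  qed simp
  with w that show thesis by (auto simp: obeying_words_def)
qed

end

section \<open>Phases counted against resamplings\<close>

definition phase_bound :: "(nat \<Rightarrow> (nat \<Rightarrow> 'a) set) \<Rightarrow> 'a msr_state \<Rightarrow> bool" where
  "phase_bound E s \<longleftrightarrow> (\<forall>u>phase s. isets s u = {}) \<and>
    (case ctrl s of
       Inner j c \<Rightarrow> phase s + 2 * c < 2 * drawn s \<and> (c = 0 \<longrightarrow> asg s \<in> E j)
     | _ \<Rightarrow> phase s < 2 * drawn s)"

text \<open>Inside a loop the term \<open>2 * c\<close> pays in advance for the phases gained at its
  exit. The clause for \<open>c = 0\<close> excludes leaving a loop without any resampling.\<close>

lemma msr_run_phase_bound: "phase_bound E (msr_run m E sc G \<omega> k)"
proof (induction k)
  case 0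
  then show ?case by (simp add: phase_bound_def msr_run_def msr_init_def)
next
  case (Suc k)
  let ?s = "msr_run m E sc G \<omega> k"
  show ?case
  proof (cases "ctrl ?s")
    case Outer
    have "asg ?s \<in> E (Min (candidates m E G ?s))" if "candidates m E G ?s \<noteq> {}"
    proof -
      have "finite (candidates m E G ?s)"
        by (simp add: candidates_def occurring_def Let_def)
      then have "Min (candidates m E G ?s) \<in> candidates m E G ?s"
        using that by (rule Min_in)
      then show ?thesis by (simp add: candidates_def occurring_def Let_def)
    qed
    with Suc Outer show ?thesis
      by (auto simp: phase_bound_def msr_run_Suc msr_step_def Let_def)
  next
    case (Inner j c)
    with Suc show ?thesis
      by (cases "c = 0") (auto simp: phase_bound_def msr_run_Suc msr_step_def Let_def)
  next
    case Stopped
    with Suc show ?thesis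
      by (simp add: phase_bound_def msr_run_Suc msr_step_def)
  qed
qed

lemma lasts_phases_drawn:
  assumes "lasts_phases m E sc G n \<omega>" "n \<ge> 1"
  obtains k where "n div 2 < drawn (msr_run m E sc G \<omega> k)"
proof -
  obtain k where k: "isets (msr_run m E sc G \<omega> k) n \<noteq> {}"
    using assms unfolding lasts_phases_def by (metis atLeastAtMost_iff order_refl)
  let ?s = "msr_run m E sc G \<omega> k"
  have "n \<le> phase ?s"
    using k msr_run_phase_bound[of E m sc G \<omega> k] unfolding phase_bound_def by (meson leI)
  moreover have "phase ?s < 2 * drawn ?s"
    using msr_run_phase_bound[of E m sc G \<omega> k] by (cases "ctrl ?s") (auto simp: phase_bound_def)
  ultimately have "n div 2 < drawn ?s" by linarith
  with that show thesis .
qed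

theorem mainTheorem4:
  fixes l m :: nat
    and M :: "nat \<Rightarrow> 'a measure"
    and E :: "nat \<Rightarrow> (nat \<Rightarrow> 'a) set"
    and sc :: "nat \<Rightarrow> nat set"
    and p :: "nat \<Rightarrow> real"
    and G :: "nat set set"
  assumes "\<And>i. i \<in> {1..l} \<Longrightarrow> prob_space (M i)"
    and "\<And>j. j \<in> {1..m} \<Longrightarrow> sc j \<subseteq> {1..l}"
    and "\<And>j. j \<in> {1..m} \<Longrightarrow> E j \<in> sets (var_space l M)"
    and "\<And>j. j \<in> {1..m} \<Longrightarrow> determined_by (var_space l M) (E j) (sc j)"
    and "\<And>j. j \<in> {1..m} \<Longrightarrow> measure (var_space l M) (E j) = p j"
    and "\<And>j. j \<in> {1..m} \<Longrightarrow> 0 < p j \<and> p j < 1"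
    and "G = d_dep_graph (var_space l M) m E sc"
    and "\<And>I. I \<in> independent_sets m G \<Longrightarrow> shearer_q m G p I > 0"
  shows "\<exists>c::real. \<exists>r::real poly. 0 < c \<and> c < 1 \<and>
           (\<forall>n\<ge>1. msr_prob l M m E sc G n \<le> poly r (real n) * c ^ n)"
proof -
  let ?W = "sample_space l M"
  have irr: "{i} \<notin> G" for i
    by (rule d_dep_graph_irrefl[OF assms(2,7)])
  obtain \<rho> C where \<rho>: "\<rho> > 1" and C: "C > 0" and decay:
    "\<And>pick upd (s :: nat set \<times> nat) N. (\<Sum>w\<in>obeying_words m G pick upd s N. prod_list (map p w)) \<le> C / \<rho> ^ N"
    using obeying_words_decay[where p = p and G = G and m = m and 's = "nat set \<times> nat"] irr assms(6,8)
    by (metis less_imp_le)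
  \<comment> \<open>The square root appears because \<open>n\<close> phases guarantee only about
    \<open>n / 2\<close> resamplings.\<close>
  define c where "c = 1 / sqrt \<rho>"
  have c: "0 < c" "c < 1" "c\<^sup>2 = 1 / \<rho>"
    using \<rho> by (simp_all add: c_def power_divide)
  interpret V: prob_space "var_space l M"
    using assms(1) by (rule prob_space_var_space)
  interpret W: prob_space ?W
    unfolding sample_space_def by (rule prob_space_PiM) (rule V.prob_space_axioms)
  have "msr_prob l M m E sc G n \<le> C / c * c ^ n" if n: "n \<ge> 1" for n
  proof -
    let ?N = "n div 2"
    let ?F = "obeying_words m G (msr_pick G) (msr_upd G) ({}, 0) ?N"
    let ?V = "\<lambda>w. {\<omega> \<in> space ?W. valid E sc w (\<omega> 0) (\<lambda>i. \<omega> (Suc i))}"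
    have F: "set w \<subseteq> {1..m}" if "w \<in> ?F" for w
      using that by (simp add: obeying_words_def)
    have Vs: "?V w \<in> sets ?W" if "w \<in> ?F" for w
      by (rule measure_valid(1)[OF assms(1-4) F[OF that]])
    \<comment> \<open>Each long run yields a valid word of length \<open>n div 2\<close> from a
      finite family, which sets up a union bound.\<close>
    have "{\<omega> \<in> space ?W. lasts_phases m E sc G n \<omega>} \<subseteq> (\<Union>w\<in>?F. ?V w)"
    proof
      fix \<omega> assume w: "\<omega> \<in> {\<omega> \<in> space ?W. lasts_phases m E sc G n \<omega>}"
      then obtain k where "?N < drawn (msr_run m E sc G \<omega> k)"
        using lasts_phases_drawn n by blast
      moreover have "\<omega> \<in> UNIV \<rightarrow> space (var_space l M)"
        using w by (auto simp: sample_space_def space_PiM)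
      ultimately obtain w where "w \<in> ?F" "valid E sc w (\<omega> 0) (\<lambda>i. \<omega> (Suc i))"
        using run_obeying_word[OF assms(2,7)] by blast
      with w show "\<omega> \<in> (\<Union>w\<in>?F. ?V w)" by blast
    qed
    then have "msr_prob l M m E sc G n \<le> measure ?W (\<Union>w\<in>?F. ?V w)"
      unfolding msr_prob_def using Vs
      by (intro W.finite_measure_mono sets.finite_UN finite_obeying_words) auto
    also have "\<dots> \<le> (\<Sum>w\<in>?F. measure ?W (?V w))"
      using Vs by (intro W.finite_measure_subadditive_finite finite_obeying_words) auto
    also have "\<dots> = (\<Sum>w\<in>?F. prod_list (map p w))"
    proof (rule sum.cong)
      fix w assume "w \<in> ?F"
      note w = F[OF this]
      have "measure ?W (?V w) = prod_list (map (\<lambda>j. measure (var_space l M) (E j)) w)"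
        by (rule measure_valid(2)[OF assms(1-4) w])
      also have "map (\<lambda>j. measure (var_space l M) (E j)) w = map p w"
        using w assms(5) by (intro map_cong) auto
      finally show "measure ?W (?V w) = prod_list (map p w)" .
    qed simp
    also have "\<dots> \<le> C / \<rho> ^ ?N"
      by (rule decay)
    also have "\<dots> = C * c ^ (2 * ?N)"
      unfolding power_mult c(3) by (simp add: power_divide)
    \<comment> \<open>For odd \<open>n\<close> rounding loses one factor \<open>c\<close>, absorbed
      by the constant polynomial \<open>C / c\<close>.\<close>
    also have "\<dots> \<le> C * c ^ (n - 1)"
      using c C by (intro mult_left_mono power_decreasing) auto
    also have "\<dots> = C / c * c ^ n"
      using n c by (cases n) auto
    finally show ?thesis .
  qed
  with c show ?thesis
    by (intro exI[of _ c] exI[of _ "[:C / c:]"]) simp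
qed

end
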